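(* Let $p>1$ and $0<\mu<\bar\lambda$, let $p^\star=1+\frac{2}{\tau^+}$ and $p^{\star\star}=1+\frac{2}{\tau^-}$, and let $u$ be a solution of $$\mathcal{M}^+(D^2u)+\mu\frac{u}{r^2}=u^p\quad\text{in } B_1\setminus\{0\}.$$ Set $K=\left[\Lambda\left(\frac{2}{p-1}-\tau^+\right)\left(\frac{2}{p-1}-\tau^-\right)\right]^{\frac{1}{p-1}}$ (when $p<p^\star$ or $p>p^{\star\star}$) and $\bar K=\left[\Lambda\tau^-(\tau-\tau^-)\right]^{\tau^-/2}$. Then: 1. If $1<p<p^\star$, then either $r^{\frac{2}{p-1}}u(r)\to K$ as $r\to 0$, or there is a constant $c_1>0$ such that $r^{\tau^+}u(r)\to c_1$ as $r\to 0$, or there is a constant $c_2>0$ such that $r^{\tau^-}u(r)\to c_2$ as $r\to 0$. 2. If $p^\star\le p<p^{\star\star}$, then there is a constant $c_2>0$ such that $r^{\tau^-}u(r)\to c_2$ as $r\to 0$. 3. If $p=p^{\star\star}$, then $r^{\tau^-}(-\log r)^{\tau^-/2}u(r)\to\bar K$ as $r\to 0$. 4. If $p>p^{\star\star}$, then $r^{\frac{2}{p-1}}u(r)\to K$ as $r\to 0$.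
   Context: Let $N$ be the space dimension, $0<\lambda\le\Lambda$, and for a symmetric $N\times N$ matrix $M$ with eigenvalues $\mu_1,\dots,\mu_N$ let $\mathcal{M}^+(M)=\Lambda\sum_{\mu_i>0}\mu_i+\lambda\sum_{\mu_i<0}\mu_i$ (Pucci's sup-operator). Set $\tilde N_+=\frac{\lambda}{\Lambda}(N-1)+1$, assume $\tilde N_+>2$, and put $\tau=\frac{\tilde N_+-2}{2}>0$, $\bar\lambda=\Lambda\tau^2$, and, for $0<\mu<\bar\lambda$, $\tau^\pm=\tau\pm\sqrt{\tau^2-\frac{\mu}{\Lambda}}$, so that $0<\tau^-<\tau<\tau^+$. $B_1$ is the open unit ball of $\mathbb{R}^N$ centered at the origin and $r=|x|$. A "solution" means a strictly positive radial function $u(x)=u(|x|)=u(r)$ of class $C^2$ in $B_1\setminus\{0\}$ satisfying the equation pointwise there. *)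

theory Defs
  imports "HOL-Analysis.Analysis"
begin

definition partial_deriv :: "'n::finite \<Rightarrow> (real ^ 'n \<Rightarrow> real) \<Rightarrow> real ^ 'n \<Rightarrow> real"
  where "partial_deriv i f x = frechet_derivative f (at x) (axis i 1)"

definition hessian :: "(real ^ 'n::finite \<Rightarrow> real) \<Rightarrow> real ^ 'n \<Rightarrow> real ^ 'n ^ 'n"
  where "hessian f x = (\<chi> i j. partial_deriv i (partial_deriv j f) x)"

(* Meant for open S only: differentiability is two-sided, not relative to S.  Continuity of
   f and of its first partial derivatives follows from their differentiability. *)
definition C2_on :: "(real ^ 'n::finite) set \<Rightarrow> (real ^ 'n \<Rightarrow> real) \<Rightarrow> bool"
  where "C2_on S f \<longleftrightarrow>
    (\<forall>x\<in>S. f differentiable (at x)) \<and>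
    (\<forall>j. \<forall>x\<in>S. partial_deriv j f differentiable (at x)) \<and>
    (\<forall>i j. continuous_on S (partial_deriv i (partial_deriv j f)))"

definition eigenspace :: "real ^ 'n ^ 'n::finite \<Rightarrow> real \<Rightarrow> (real ^ 'n) set"
  where "eigenspace M t = {v. M *v v = t *\<^sub>R v}"

definition eigenvalues :: "real ^ 'n ^ 'n::finite \<Rightarrow> real set"
  where "eigenvalues M = {t. \<exists>v. v \<noteq> 0 \<and> v \<in> eigenspace M t}"

(* Pucci's sup-operator for symmetric M.  The eigenvalues of M listed with multiplicity are its
   distinct eigenvalues t, each repeated dim (eigenspace M t) times; for symmetric M this is also
   the multiplicity of t as a root of the characteristic polynomial.  The index sets are finite
   for every M, so neither sum takes the default value 0 of infinite sums. *)
definition pucci_sup :: "real \<Rightarrow> real \<Rightarrow> real ^ 'n ^ 'n::finite \<Rightarrow> real"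
  where "pucci_sup lam Lam M =
    Lam * (\<Sum>t\<in>{t \<in> eigenvalues M. t > 0}. real (dim (eigenspace M t)) * t) +
    lam * (\<Sum>t\<in>{t \<in> eigenvalues M. t < 0}. real (dim (eigenspace M t)) * t)"

definition punctured_ball :: "(real ^ 'n::finite) set"
  where "punctured_ball = ball 0 1 - {0}"

(* U is the radial profile of u, i.e. u(x) = U(r) with r = |x|; only its values on the open
   interval (0,1) matter. *)
definition radial_solution ::
    "real \<Rightarrow> real \<Rightarrow> real \<Rightarrow> real \<Rightarrow> (real ^ 'n::finite \<Rightarrow> real) \<Rightarrow> (real \<Rightarrow> real) \<Rightarrow> bool"
  where "radial_solution lam Lam mu p u U \<longleftrightarrow>
    (\<forall>x\<in>punctured_ball. u x = U (norm x)) \<and>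
    (\<forall>x\<in>punctured_ball. u x > 0) \<and>
    C2_on punctured_ball u \<and>
    (\<forall>x\<in>punctured_ball.
       pucci_sup lam Lam (hessian u x) + mu * u x / (norm x)\<^sup>2 = u x powr p)"

end

theory Submission imports Defs begin

text \<open>On radial functions the equation becomes an autonomous planar system: with \<open>t = - ln r\<close>,
  \<open>h = - r U' / U\<close> and \<open>w = r\<^sup>2 U powr (p - 1)\<close> one has \<open>h' = f h w\<close> and
  \<open>w' = (p - 1) * (h - al) * w\<close>, where \<open>al = 2 / (p - 1)\<close> and \<open>f\<close> is strictly increasing in \<open>w\<close>.
  Such a cooperative system has no oscillating trajectories: \<open>h\<close> eventually stays on one side of \<open>al\<close>,
  so \<open>w\<close> is eventually monotone, it is bounded by a Keller--Osserman argument, and then \<open>h\<close> converges too.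
  Hence \<open>(h, w)\<close> tends to one of the rest points \<open>(tp, 0)\<close>, \<open>(tm, 0)\<close> and \<open>(al, P al)\<close>,
  where \<open>tp = \<tau>\<^sup>+\<close>, \<open>tm = \<tau>\<^sup>-\<close> and \<open>P x = Lam * (x - tp) * (x - tm)\<close>.  At all of them the profile is decreasing and convex, so that
  finally \<open>Lam * h' = w - P h\<close> whatever the signs were before, and the asymptotics of \<open>U\<close> follow from this
  equation near each rest point; at \<open>al = tm\<close> the logarithm comes from the center manifold.\<close>

subsection \<open>Pucci's operator on radial functions\<close>

text \<open>Pucci's operator in dimension one. On diagonal matrices the full operator can then be
  evaluated entry by entry, without eigenspaces.\<close>

definition pucci1 :: "real \<Rightarrow> real \<Rightarrow> real \<Rightarrow> real"
  where "pucci1 lam Lam a = Lam * max a 0 + lam * min a 0"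

section \<open>Pucci's operator on diagonal matrices\<close>

definition diagonal :: "('n::finite \<Rightarrow> real) \<Rightarrow> real ^ 'n ^ 'n"
  where "diagonal d = (\<chi> i j. if i = j then d i else 0)"

lemma diagonal_mult_vec: "(diagonal d *v v) $ i = d i * v $ i"
proof -
  have "(\<Sum>j\<in>UNIV. (if i = j then d i else 0) * v $ j) = (\<Sum>j\<in>UNIV. if i = j then d i * v $ j else 0)"
    by (rule sum.cong) auto
  then show ?thesis
    by (simp add: diagonal_def matrix_vector_mult_def)
qed

lemma axis_nth: "axis i c $ j = (if i = j then c else 0)"
  by (simp add: axis_def)

lemma eigenspace_diagonal: "eigenspace (diagonal d) t = {v. \<forall>i. i \<notin> {i. d i = t} \<longrightarrow> v $ i = 0}"
  by (auto simp: eigenspace_def vec_eq_iff diagonal_mult_vec)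

lemma dim_eigenspace_diagonal: "dim (eigenspace (diagonal d) t) = card {i. d i = t}"
  unfolding eigenspace_diagonal using dim_substandard_cart[of "{i. d i = t}", where 'a = real]
  by (simp add: dim_vec_eq)

lemma eigenvalues_diagonal: "eigenvalues (diagonal d) = range d"
proof (intro set_eqI iffI)
  fix t assume "t \<in> eigenvalues (diagonal d)"
  then obtain v where "v \<noteq> 0" "v \<in> eigenspace (diagonal d) t"
    by (auto simp: eigenvalues_def)
  then show "t \<in> range d"
    by (auto simp: eigenspace_diagonal vec_eq_iff)
next
  fix t assume "t \<in> range d"
  then obtain i where "t = d i" by auto
  then have "axis i 1 \<in> eigenspace (diagonal d) t" "axis i 1 \<noteq> (0 :: real ^ 'a)"
    by (auto simp: eigenspace_diagonal axis_def vec_eq_iff)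
  then show "t \<in> eigenvalues (diagonal d)"
    unfolding eigenvalues_def by blast
qed

text \<open>The multiplicity of \<open>t\<close> is the number of indices \<open>i\<close> with
  \<open>d i = t\<close>, so grouping the indices by value gives a plain sum. The predicate
  \<open>P\<close> is general in order to serve both signs.\<close>

lemma sum_eigenvalues_diagonal:
  fixes d :: "'n::finite \<Rightarrow> real"
  shows "(\<Sum>t\<in>{t \<in> eigenvalues (diagonal d). P t}. real (dim (eigenspace (diagonal d) t)) * t)
    = (\<Sum>i | P (d i). d i)"
proof -
  have "(\<Sum>t\<in>{t \<in> range d. P t}. real (card {i. d i = t}) * t)
      = (\<Sum>t\<in>{t \<in> range d. P t}. \<Sum>i\<in>{i \<in> {i. P (d i)}. d i = t}. d i)"
  proof (rule sum.cong[OF refl])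
    fix t assume "t \<in> {t \<in> range d. P t}"
    then have "{i \<in> {i. P (d i)}. d i = t} = {i. d i = t}" by auto
    then show "real (card {i. d i = t}) * t = (\<Sum>i\<in>{i \<in> {i. P (d i)}. d i = t}. d i)"
      by simp
  qed
  also have "\<dots> = (\<Sum>i | P (d i). d i)"
    by (rule sum.group) auto
  finally show ?thesis
    by (simp add: eigenvalues_diagonal dim_eigenspace_diagonal)
qed

lemma pucci_sup_diagonal:
  fixes d :: "'n::finite \<Rightarrow> real"
  shows "pucci_sup lam Lam (diagonal d) = (\<Sum>i\<in>UNIV. pucci1 lam Lam (d i))"
proof -
  have "(\<Sum>i | d i > 0. d i) = (\<Sum>i\<in>UNIV. max (d i) 0)" "(\<Sum>i | d i < 0. d i) = (\<Sum>i\<in>UNIV. min (d i) 0)"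
    by (auto intro!: sum.mono_neutral_cong_left simp: max_def min_def split: if_splits)
  then show ?thesis
    by (simp add: pucci_sup_def sum_eigenvalues_diagonal pucci1_def sum.distrib sum_distrib_left)
qed

section \<open>Gradient and Hessian of radial functions\<close>

lemma partial_deriv_eqI:
  assumes "(f has_derivative f') (at x)"
  shows "partial_deriv i f x = f' (axis i 1)"
  unfolding partial_deriv_def using frechet_derivative_at[OF assms] by simp

lemma partial_deriv_along_axis:
  assumes "f differentiable (at (r *\<^sub>R axis i 1))"
  shows "((\<lambda>s. f (s *\<^sub>R axis i 1)) has_real_derivative partial_deriv i f (r *\<^sub>R axis i 1)) (at r)"
proof -
  let ?D = "frechet_derivative f (at (r *\<^sub>R axis i 1))"
  have 1: "(f has_derivative ?D) (at (r *\<^sub>R axis i 1))"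
    using assms by (simp add: frechet_derivative_works)
  have "((\<lambda>s. f (s *\<^sub>R axis i 1)) has_derivative (\<lambda>h. ?D (h *\<^sub>R axis i 1))) (at r)"
    by (rule has_derivative_compose[where g = f and f = "\<lambda>s. s *\<^sub>R axis i 1", OF _ 1]) (auto intro!: derivative_eq_intros)
  moreover have "?D (h *\<^sub>R axis i 1) = partial_deriv i f (r *\<^sub>R axis i 1) * h" for h
    using linear_cmul[OF has_derivative_linear[OF 1]] by (simp add: partial_deriv_def)
  ultimately show ?thesis
    by (simp add: has_field_derivative_def)
qed

lemma open_punctured_ball: "open punctured_ball"
  by (simp add: punctured_ball_def open_delete)

lemma axis_in_punctured_ball:
  "0 < r \<Longrightarrow> r < 1 \<Longrightarrow> r *\<^sub>R axis k 1 \<in> punctured_ball"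
  by (auto simp: punctured_ball_def)

context
  fixes lam Lam mu p :: real and u :: "real ^ 'n::finite \<Rightarrow> real" and U :: "real \<Rightarrow> real"
  assumes sol: "radial_solution lam Lam mu p u U"
begin

text \<open>Restriction to a coordinate ray turns differentiability of \<open>u\<close> into
  differentiability of the profile: \<open>U1\<close> and \<open>U2\<close> are the first and second
  partial derivatives of \<open>u\<close> in the direction of the ray.\<close>

lemma radial_profile_derivs:
  obtains U1 U2 where
    "\<And>r. 0 < r \<Longrightarrow> r < 1 \<Longrightarrow> (U has_real_derivative U1 r) (at r)"
    "\<And>r. 0 < r \<Longrightarrow> r < 1 \<Longrightarrow> (U1 has_real_derivative U2 r) (at r)"
proof -
  fix k :: 'n
  let ?e = "axis k 1 :: real ^ 'n"
  have u_eq: "u (r *\<^sub>R ?e) = U r" if "r \<in> {0<..<1}" for r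
    using sol that axis_in_punctured_ball[of r k] by (auto simp: radial_solution_def)
  show ?thesis
  proof (rule that)
    fix r :: real assume r: "0 < r" "r < 1"
    have "u differentiable (at (r *\<^sub>R ?e))"
      "partial_deriv k u differentiable (at (r *\<^sub>R ?e))"
      using sol axis_in_punctured_ball[OF r, of k] by (auto simp: radial_solution_def C2_on_def)
    note D = this[THEN partial_deriv_along_axis]
    show "(U has_real_derivative partial_deriv k u (r *\<^sub>R ?e)) (at r)"
      using r by (intro has_field_derivative_transform_within_open[OF D(1), of "{0<..<1}"]) (auto simp: u_eq)
    show "((\<lambda>s. partial_deriv k u (s *\<^sub>R ?e)) has_real_derivative
        partial_deriv k (partial_deriv k u) (r *\<^sub>R ?e)) (at r)"
      by (rule D(2))
  qed
qed

lemma partial_deriv_radial: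
  assumes "x \<in> punctured_ball" "(U has_real_derivative D) (at (norm x))"
  shows "partial_deriv j u x = D * x $ j / norm x"
proof -
  have x: "x \<noteq> 0" "norm x \<noteq> 0" using assms by (auto simp: punctured_ball_def)
  have "((\<lambda>y. U (norm y)) has_derivative (\<lambda>y. D * (inner x y / norm x))) (at x)"
    using has_derivative_compose[OF has_derivative_norm[OF x(1)] assms(2)[unfolded has_field_derivative_def]]
    by (simp add: sgn_div_norm divide_inverse_commute inner_commute)
  then have "(u has_derivative (\<lambda>y. D * (inner x y / norm x))) (at x)"
    by (rule has_derivative_transform_within_open[OF _ open_punctured_ball assms(1)])
      (use sol in \<open>auto simp: radial_solution_def\<close>)
  from partial_deriv_eqI[OF this, of j] show ?thesis
    by (simp add: inner_axis)
qed

text \<open>A radial Hessian acts as \<open>U''\<close> in the radial direction and as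
  \<open>U' / r\<close> in the tangential ones. On a coordinate axis these are coordinate
  directions, so the matrix is already diagonal.\<close>

lemma hessian_radial:
  assumes U1: "\<And>r. 0 < r \<Longrightarrow> r < 1 \<Longrightarrow> (U has_real_derivative U1 r) (at r)"
    and U2: "(U1 has_real_derivative d) (at r)" and r: "0 < r" "r < 1"
  shows "hessian u (r *\<^sub>R axis k 1) = diagonal (\<lambda>i. if i = k then d else U1 r / r)"
proof -
  let ?x = "r *\<^sub>R axis k 1 :: real ^ 'n"
  have x: "?x \<in> punctured_ball" "?x \<noteq> 0" "norm ?x = r"
    using axis_in_punctured_ball[OF r, of k] r by (auto simp: punctured_ball_def)
  have nz: "norm ?x \<noteq> 0" using x by simp
  have "partial_deriv i (partial_deriv j u) ?x = (if i = j then if i = k then d else U1 r / r else 0)" for i j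
  proof -
    \<comment> \<open>The first partial derivative has to be known near \<open>?x\<close> before it
      is differentiated there; splitting off the direction cosine prepares the product and quotient
      rules.\<close>
    have E: "partial_deriv j u y = U1 (norm y) * (y $ j / norm y)" if "y \<in> punctured_ball" for y
      using partial_deriv_radial[OF that U1] that by (auto simp: punctured_ball_def)
    have N: "(norm has_derivative (\<lambda>y. inner y (sgn ?x))) (at ?x)"
      by (rule has_derivative_norm[OF x(2)])
    have U2': "(U1 has_derivative (*) d) (at (norm ?x))"
      using U2 x(3) by (simp add: has_field_derivative_def)
    have V: "((\<lambda>y. U1 (norm y)) has_derivative (\<lambda>y. d * inner y (sgn ?x))) (at ?x)"
      using has_derivative_compose[OF N U2'] by simp
    have C: "((\<lambda>y. y $ j) has_derivative (\<lambda>y. y $ j)) (at ?x)"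
      by (rule bounded_linear_imp_has_derivative[OF bounded_linear_vec_nth])
    have "((\<lambda>y. U1 (norm y) * (y $ j / norm y)) has_derivative
       (\<lambda>y. U1 (norm ?x) * ((y $ j * norm ?x - ?x $ j * inner y (sgn ?x)) / (norm ?x * norm ?x))
          + d * inner y (sgn ?x) * (?x $ j / norm ?x))) (at ?x)"
      by (rule has_derivative_mult[OF V has_derivative_divide'[OF C N nz]])
    then have "(partial_deriv j u has_derivative
       (\<lambda>y. U1 (norm ?x) * ((y $ j * norm ?x - ?x $ j * inner y (sgn ?x)) / (norm ?x * norm ?x))
          + d * inner y (sgn ?x) * (?x $ j / norm ?x))) (at ?x)"
      by (rule has_derivative_transform_within_open[OF _ open_punctured_ball x(1)]) (simp add: E)
    from partial_deriv_eqI[OF this, of i] show ?thesis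
      using r by (auto simp: x(3) sgn_div_norm inner_axis_axis axis_nth)
  qed
  then show ?thesis
    by (auto simp: hessian_def diagonal_def vec_eq_iff)
qed

lemma radial_profile_pos: "0 < r \<Longrightarrow> r < 1 \<Longrightarrow> U r > 0"
  using sol axis_in_punctured_ball[of r undefined] unfolding radial_solution_def
  by (metis norm_axis_1 norm_scaleR abs_of_pos mult.right_neutral)

text \<open>The equation is tested at a point of a coordinate axis, where the diagonal contains
  \<open>U''\<close> once and \<open>U' / r\<close> in all other places.\<close>

lemma radial_ode:
  assumes "\<And>r. 0 < r \<Longrightarrow> r < 1 \<Longrightarrow> (U has_real_derivative U1 r) (at r)"
    and "(U1 has_real_derivative d) (at r)" and r: "0 < r" "r < 1"
  shows "pucci1 lam Lam d + (real CARD('n) - 1) * pucci1 lam Lam (U1 r / r) + mu * U r / r\<^sup>2 = U r powr p"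
proof -
  fix k :: 'n
  let ?x = "r *\<^sub>R axis k 1 :: real ^ 'n"
  have "pucci_sup lam Lam (hessian u ?x)
      = (\<Sum>i\<in>UNIV. pucci1 lam Lam (if i = k then d else U1 r / r))"
    by (simp only: hessian_radial[OF assms] pucci_sup_diagonal)
  also have "\<dots> = pucci1 lam Lam d + (\<Sum>i\<in>UNIV - {k}. pucci1 lam Lam (if i = k then d else U1 r / r))"
    by (subst sum.remove[of _ k]) auto
  also have "(\<Sum>i\<in>UNIV - {k}. pucci1 lam Lam (if i = k then d else U1 r / r))
      = (\<Sum>i\<in>UNIV - {k}. pucci1 lam Lam (U1 r / r))"
    by (rule sum.cong) auto
  also have "\<dots> = (real CARD('n) - 1) * pucci1 lam Lam (U1 r / r)"
    by (simp add: card_Diff_singleton of_nat_diff)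
  finally show ?thesis
    using sol axis_in_punctured_ball[OF r, of k] r by (auto simp: radial_solution_def)
qed

end

subsection \<open>Real functions at infinity\<close>

text \<open>Take \<open>s\<close> as the largest point of the compact set where \<open>g\<close> is
  nonnegative. The intermediate value theorem gives a zero in \<open>{s..b}\<close>, and only
  \<open>s\<close> itself can be one.\<close>

lemma last_crossing:
  fixes g :: "real \<Rightarrow> real"
  assumes "a \<le> b" "continuous_on {a..b} g" "g a \<ge> 0" "g b < 0"
  obtains s where "a \<le> s" "s < b" "g s = 0" "\<And>x. s < x \<Longrightarrow> x \<le> b \<Longrightarrow> g x < 0"
proof -
  let ?A = "{a..b} \<inter> g -` {0..}"
  have "compact ({a..b} \<inter> ?A)"
    using assms(2) by (intro compact_Int_closed continuous_closed_preimage) auto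
  then have "compact ?A" by (simp add: Int_absorb2 Int_assoc[symmetric])
  moreover have "a \<in> ?A" using assms by auto
  ultimately obtain s where s: "s \<in> ?A" "\<And>x. x \<in> ?A \<Longrightarrow> x \<le> s"
    using compact_attains_sup[of ?A] by blast
  have neg: "g x < 0" if "s < x" "x \<le> b" for x
    using s(1) s(2)[of x] that by (auto simp: not_le[symmetric])
  have "s < b" using s assms(4) by (cases "s = b") auto
  moreover have "g s = 0"
  proof -
    have "continuous_on {s..b} g"
      using assms(2) s(1) by (auto intro: continuous_on_subset)
    then obtain x where "s \<le> x" "x \<le> b" "g x = 0"
      using IVT2'[of g b 0 s] s(1) assms(4) \<open>s < b\<close> by auto
    then show ?thesis using neg[of x] by (cases "s = x") auto
  qed
  ultimately show ?thesis using that s(1) neg by auto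
qed

text \<open>Reflection \<open>x -> - x\<close> exchanges first and last crossings.\<close>

lemma first_crossing:
  fixes g :: "real \<Rightarrow> real"
  assumes "a \<le> b" "continuous_on {a..b} g" "g a < 0" "g b \<ge> 0"
  obtains s where "a < s" "s \<le> b" "g s = 0" "\<And>x. a \<le> x \<Longrightarrow> x < s \<Longrightarrow> g x < 0"
proof -
  have "continuous_on {-b..-a} (\<lambda>x. g (- x))"
    by (rule continuous_on_compose2[OF assms(2)]) (auto intro!: continuous_intros)
  from last_crossing[OF _ this] assms obtain s
    where s: "-b \<le> s" "s < -a" "g (-s) = 0" "\<And>x. s < x \<Longrightarrow> x \<le> -a \<Longrightarrow> g (-x) < 0"
    by auto
  show ?thesis
    by (rule that[of "-s"]) (use s(1-3) s(4)[of "- _"] in \<open>auto simp: minus_less_iff\<close>)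
qed

lemma continuous_on_Icc_if_deriv:
  fixes g :: "real \<Rightarrow> real"
  assumes "\<And>t. a \<le> t \<Longrightarrow> (g has_real_derivative g' t) (at t)" "a \<le> c"
  shows "continuous_on {c..d} g"
  using assms by (intro DERIV_continuous_on[of _ g g']) (auto intro: has_field_derivative_at_within)

text \<open>Right after the last zero before a negative value, the positive derivative would keep
  \<open>g\<close> above zero. The strict conclusion follows since a later zero would be preceded by
  negative values.\<close>

lemma barrier:
  fixes g :: "real \<Rightarrow> real"
  assumes deriv: "\<And>t. a \<le> t \<Longrightarrow> (g has_real_derivative g' t) (at t)"
    and up: "\<And>t. a \<le> t \<Longrightarrow> g t = 0 \<Longrightarrow> g' t > 0"
    and "g a \<ge> 0" "a < t"
  shows "g t > 0"
proof -
  have cont: "continuous_on {c..d} g" if "a \<le> c" for c d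
    using deriv that by (rule continuous_on_Icc_if_deriv)
  have nonneg: "g x \<ge> 0" if "a \<le> x" for x
  proof (rule ccontr)
    assume "\<not> g x \<ge> 0"
    with last_crossing[OF that cont] \<open>g a \<ge> 0\<close> obtain s
      where s: "a \<le> s" "s < x" "g s = 0" "\<And>y. s < y \<Longrightarrow> y \<le> x \<Longrightarrow> g y < 0"
      by (metis not_le order_refl)
    from DERIV_pos_inc_right[OF deriv up] s obtain d
      where d: "d > 0" "\<And>k. 0 < k \<Longrightarrow> k < d \<Longrightarrow> g s < g (s + k)" by blast
    define k where "k = min (d / 2) (x - s)"
    have "0 < k" "k < d" "s + k \<le> x" using d s by (auto simp: k_def)
    then show False using d(2)[of k] s(3) s(4)[of "s + k"] by auto
  qed
  show ?thesis
  proof (rule ccontr)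
    assume "\<not> g t > 0"
    then have "g t = 0" using nonneg[of t] \<open>a < t\<close> by auto
    then obtain d where d: "d > 0" "\<And>k. 0 < k \<Longrightarrow> k < d \<Longrightarrow> g (t - k) < g t"
      using DERIV_pos_inc_left[OF deriv up, of t] \<open>a < t\<close> by auto
    define k where "k = min (d / 2) (t - a)"
    have "0 < k" "k < d" "a \<le> t - k" using d \<open>a < t\<close> by (auto simp: k_def)
    then show False using d(2)[of k] nonneg[of "t - k"] \<open>g t = 0\<close> by auto
  qed
qed

section \<open>Limits at infinity from bounds on derivatives\<close>

lemma deriv_ge_imp_ge_linear:
  fixes g :: "real \<Rightarrow> real"
  assumes "\<And>t. a \<le> t \<Longrightarrow> (g has_real_derivative g' t) (at t)" "\<And>t. a \<le> t \<Longrightarrow> c \<le> g' t" "a \<le> t"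
  shows "g a + c * (t - a) \<le> g t"
proof -
  have "g a - c * a \<le> g t - c * t"
  proof (rule DERIV_nonneg_imp_nondecreasing[OF assms(3)])
    fix x assume "a \<le> x" "x \<le> t"
    then show "\<exists>y. ((\<lambda>t. g t - c * t) has_real_derivative y) (at x) \<and> 0 \<le> y"
      using assms(1,2)[of x] by (intro exI[of _ "g' x - c"]) (auto intro!: derivative_eq_intros)
  qed
  then show ?thesis by (simp add: algebra_simps)
qed

lemma filterlim_at_top_if_deriv_ge:
  fixes g :: "real \<Rightarrow> real"
  assumes "\<forall>\<^sub>F t in at_top. (g has_real_derivative g' t) (at t)" "\<forall>\<^sub>F t in at_top. c \<le> g' t" "0 < c"
  shows "filterlim g at_top at_top"
proof -
  obtain a where a: "\<And>t. a \<le> t \<Longrightarrow> (g has_real_derivative g' t) (at t) \<and> c \<le> g' t"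
    using eventually_conj[OF assms(1,2)] by (auto simp: eventually_at_top_linorder)
  have "filterlim (\<lambda>t. (g a - c * a) + c * t) at_top at_top"
    by (intro filterlim_tendsto_add_at_top[OF tendsto_const]
        filterlim_tendsto_pos_mult_at_top[OF tendsto_const \<open>0 < c\<close>] filterlim_ident)
  moreover have "\<forall>\<^sub>F t in at_top. (g a - c * a) + c * t \<le> g t"
    using eventually_ge_at_top[of a]
  proof eventually_elim
    case (elim t)
    with deriv_ge_imp_ge_linear[of a g g' c t] a show ?case by (simp add: algebra_simps)
  qed
  ultimately show ?thesis by (rule filterlim_at_top_mono)
qed

text \<open>A derivative with positive limit makes \<open>g\<close> tend to infinity, and a negative
  limit reduces to this by passing to \<open>- g\<close>. Used to show that limits of trajectories
  are rest points.\<close>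

lemma tendsto_deriv_imp_zero:
  fixes g :: "real \<Rightarrow> real"
  assumes g: "(g \<longlongrightarrow> l) at_top" and deriv: "\<forall>\<^sub>F t in at_top. (g has_real_derivative g' t) (at t)"
    and g': "(g' \<longlongrightarrow> d) at_top"
  shows "d = 0"
proof -
  have False if g: "(g \<longlongrightarrow> l) at_top" and deriv: "\<forall>\<^sub>F t in at_top. (g has_real_derivative g' t) (at t)"
    and g': "(g' \<longlongrightarrow> d) at_top" and "d > 0" for g g' :: "real \<Rightarrow> real" and l d
  proof -
    have "\<forall>\<^sub>F t in at_top. d / 2 \<le> g' t"
      using order_tendstoD(1)[OF g', of "d / 2"] \<open>d > 0\<close> by (auto elim: eventually_mono)
    with filterlim_at_top_if_deriv_ge[OF deriv this] \<open>d > 0\<close> have "filterlim g at_top at_top" by simp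
    with g show False
      by (meson filterlim_at_top_imp_at_infinity not_tendsto_and_filterlim_at_infinity trivial_limit_at_top_linorder)
  qed note * = this
  have "\<forall>\<^sub>F t in at_top. ((\<lambda>t. - g t) has_real_derivative - g' t) (at t)"
    using deriv by (rule eventually_mono) (rule DERIV_minus)
  then show ?thesis
    using *[OF assms] *[OF tendsto_minus[OF g] _ tendsto_minus[OF g']]
    by (cases d "0 :: real" rule: linorder_cases) auto
qed

lemma mono_bounded_tendsto_at_top:
  fixes g :: "real \<Rightarrow> real"
  assumes mono: "\<And>s t. a \<le> s \<Longrightarrow> s \<le> t \<Longrightarrow> g s \<le> g t" and bound: "\<And>t. a \<le> t \<Longrightarrow> g t \<le> B"
  shows "\<exists>l. (g \<longlongrightarrow> l) at_top"
proof (intro exI increasing_tendsto)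
  have bdd: "bdd_above (g ` {a..})" using bound by (auto intro!: bdd_aboveI)
  show "\<forall>\<^sub>F t in at_top. g t \<le> (SUP t\<in>{a..}. g t)"
    using eventually_ge_at_top[of a] by eventually_elim (auto intro: cSUP_upper[OF _ bdd])
  fix x assume "x < (SUP t\<in>{a..}. g t)"
  then obtain s where "a \<le> s" "x < g s" using less_cSUP_iff[OF _ bdd] by auto
  then have "\<forall>t\<ge>s. x < g t" using mono by (meson less_le_trans)
  then show "\<forall>\<^sub>F t in at_top. x < g t" unfolding eventually_at_top_linorder ..
qed

lemma deriv_nonneg_bounded_tendsto_at_top:
  fixes g :: "real \<Rightarrow> real"
  assumes "\<forall>\<^sub>F t in at_top. (g has_real_derivative g' t) (at t)" "\<forall>\<^sub>F t in at_top. 0 \<le> g' t"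
    and "\<forall>\<^sub>F t in at_top. g t \<le> B"
  shows "\<exists>l. (g \<longlongrightarrow> l) at_top"
proof -
  obtain a where a: "\<And>t. a \<le> t \<Longrightarrow> (g has_real_derivative g' t) (at t) \<and> 0 \<le> g' t \<and> g t \<le> B"
    using eventually_conj[OF assms(1) eventually_conj[OF assms(2,3)]]
    by (auto simp: eventually_at_top_linorder)
  show ?thesis
  proof (rule mono_bounded_tendsto_at_top)
    fix s t assume "a \<le> s" "s \<le> t"
    then show "g s \<le> g t"
      using a by (intro DERIV_nonneg_imp_nondecreasing[of s t g]) (auto intro: order_trans)
  qed (use a in auto)
qed

text \<open>If \<open>y b\<close> were positive, the level \<open>y b / 2\<close> would be a
  barrier, since \<open>y\<close> increases wherever it is positive; this contradicts the limit
  zero.\<close>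

lemma repelled_tendsto_zero_nonpos:
  fixes y :: "real \<Rightarrow> real"
  assumes "(y \<longlongrightarrow> 0) at_top" "\<forall>\<^sub>F t in at_top. (y has_real_derivative y' t) (at t)"
    and "\<forall>\<^sub>F t in at_top. y t > 0 \<longrightarrow> y' t > 0"
  shows "\<forall>\<^sub>F t in at_top. y t \<le> 0"
proof -
  obtain a where a: "\<And>t. a \<le> t \<Longrightarrow> (y has_real_derivative y' t) (at t) \<and> (y t > 0 \<longrightarrow> y' t > 0)"
    using eventually_conj[OF assms(2,3)] by (auto simp: eventually_at_top_linorder)
  have "y b \<le> 0" if "a \<le> b" for b
  proof (rule ccontr)
    assume b: "\<not> y b \<le> 0"
    have "y t - y b / 2 > 0" if "b < t" for t
      by (rule barrier[where g = "\<lambda>t. y t - y b / 2" and g' = y' and a = b])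
        (use a b \<open>a \<le> b\<close> that in \<open>auto intro!: derivative_eq_intros\<close>)
    then have "\<And>t. b < t \<Longrightarrow> y b / 2 \<le> y t" by (simp add: less_imp_le)
    then have "\<forall>\<^sub>F t in at_top. y b / 2 \<le> y t"
      using eventually_gt_at_top[of b] by (rule eventually_mono[rotated])
    from tendsto_lowerbound[OF assms(1) this] b show False by simp
  qed
  then show ?thesis by (auto simp: eventually_at_top_linorder)
qed

lemma eventually_bounded_if_deriv_nonpos:
  fixes g :: "real \<Rightarrow> real"
  assumes "\<forall>\<^sub>F t in at_top. (g has_real_derivative g' t) (at t)" "\<forall>\<^sub>F t in at_top. g' t \<le> 0"
  obtains B where "\<forall>\<^sub>F t in at_top. g t \<le> B"
proof -
  obtain a where a: "\<And>t. a \<le> t \<Longrightarrow> (g has_real_derivative g' t) (at t) \<and> g' t \<le> 0"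
    using eventually_conj[OF assms] by (auto simp: eventually_at_top_linorder)
  have "g t \<le> g a" if "a \<le> t" for t
    using a by (intro DERIV_nonpos_imp_nonincreasing[OF that]) blast
  then show ?thesis using that by (auto simp: eventually_at_top_linorder)
qed

subsection \<open>Convergence of the planar flow\<close>

text \<open>The inverse function of \<open>pucci1\<close> for positive \<open>lam\<close> and
  \<open>Lam\<close>; it solves the radial equation for \<open>U''\<close>.\<close>

definition pucci1_inv :: "real \<Rightarrow> real \<Rightarrow> real \<Rightarrow> real"
  where "pucci1_inv lam Lam s = max s 0 / Lam + min s 0 / lam"

text \<open>In the variable \<open>t = - ln r\<close>, \<open>h = - r U' / U\<close> has derivative
  \<open>r^2 U'' / U - h - h^2\<close>. The term with \<open>pucci1_inv\<close> is
  \<open>r^2 U'' / U\<close> as given by the equation.\<close>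

definition slope_field :: "real \<Rightarrow> real \<Rightarrow> real \<Rightarrow> real \<Rightarrow> real \<Rightarrow> real \<Rightarrow> real"
  where "slope_field lam Lam mu n h w = pucci1_inv lam Lam (w - mu - n * pucci1 lam Lam (- h)) - h - h\<^sup>2"

text \<open>Here \<open>n = N - 1\<close>; the exponents \<open>tp = \<tau>\<^sup>+\<close> and \<open>tm = \<tau>\<^sup>-\<close> enter only through their sum
  \<open>2 \<tau>\<close> and their product \<open>\<mu> / \<Lambda>\<close>, and \<open>L\<close> is \<open>ln U\<close> in the variable \<open>t\<close>.\<close>
locale pucci_flow =
  fixes lam Lam mu n p tp tm :: real and L h :: "real \<Rightarrow> real"
  assumes lam_pos: "0 < lam" and lam_le: "lam \<le> Lam"
    and tp_tm_sum: "Lam * (tp + tm) = lam * n - Lam" and tp_tm_prod: "Lam * (tp * tm) = mu"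
    and tm_pos: "0 < tm" and tm_less_tp: "tm < tp" and p_gt_1: "1 < p"
    and L_deriv: "\<And>t. 0 < t \<Longrightarrow> (L has_real_derivative h t) (at t)"
    and h_deriv: "\<And>t. 0 < t \<Longrightarrow>
      (h has_real_derivative slope_field lam Lam mu n (h t) (exp ((p - 1) * L t - 2 * t))) (at t)"
begin

abbreviation "f \<equiv> slope_field lam Lam mu n"

definition al :: real where "al = 2 / (p - 1)"
definition w :: "real \<Rightarrow> real" where "w t = exp ((p - 1) * L t - 2 * t)"
text \<open>The characteristic polynomial: for \<open>x > 0\<close>, Pucci's operator plus the
  potential term sends \<open>r^(-x)\<close> to \<open>P x\<close> times
  \<open>r^(-x-2)\<close>.\<close>

definition P :: "real \<Rightarrow> real" where "P x = Lam * ((x - tp) * (x - tm))"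

lemma Lam_pos: "0 < Lam" using lam_pos lam_le by simp
lemma tp_pos: "0 < tp" using tm_pos tm_less_tp by simp
lemma mu_pos: "0 < mu" using tp_tm_prod Lam_pos tp_pos tm_pos by auto
lemma al_pos: "0 < al" using p_gt_1 by (simp add: al_def)
lemma al_eq: "(p - 1) * al = 2" using p_gt_1 by (simp add: al_def field_simps)

lemma n_gt_1: "1 < n"
proof -
  have "0 < Lam * (tp + tm)" using Lam_pos tp_pos tm_pos by auto
  then have "lam * 1 < lam * n" using tp_tm_sum lam_le by simp
  then show ?thesis using lam_pos by simp
qed

lemma P_expand: "P x = Lam * x\<^sup>2 + Lam * x - lam * n * x + mu"
  using tp_tm_sum tp_tm_prod by (simp add: P_def power2_eq_square) algebra

lemma w_pos: "0 < w t" by (simp add: w_def)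

lemma h_deriv': "0 < t \<Longrightarrow> (h has_real_derivative f (h t) (w t)) (at t)"
  using h_deriv by (simp add: w_def)

lemma w_deriv: "0 < t \<Longrightarrow> (w has_real_derivative (p - 1) * (h t - al) * w t) (at t)"
  unfolding w_def using al_eq
  by (auto intro!: derivative_eq_intros L_deriv simp: algebra_simps)

lemma continuous_on_h: "0 < a \<Longrightarrow> continuous_on {a..b} h"
  by (rule continuous_on_Icc_if_deriv[OF h_deriv', of a]) auto

section \<open>Monotonicity, bounds and zeros of the slope field\<close>

lemma f_le: "f x y \<le> max (y - mu - n * pucci1 lam Lam (- x)) 0 / Lam - x - x\<^sup>2"
  using lam_pos by (simp add: slope_field_def pucci1_inv_def divide_nonpos_pos)

text \<open>This is the cooperativity of the system. Strictness comes from whichever of the two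
  linear pieces of \<open>pucci1_inv\<close> is active.\<close>

lemma f_mono: "y1 < y2 \<Longrightarrow> f x y1 < f x y2"
proof -
  assume "y1 < y2"
  have "pucci1_inv lam Lam s1 < pucci1_inv lam Lam s2" if "s1 < s2" for s1 s2
  proof -
    have "max s1 0 / Lam \<le> max s2 0 / Lam" "min s1 0 / lam \<le> min s2 0 / lam"
      using that lam_pos Lam_pos by (auto intro!: divide_right_mono)
    moreover have "max s1 0 / Lam < max s2 0 / Lam \<or> min s1 0 / lam < min s2 0 / lam"
      using that lam_pos Lam_pos by (cases "s1 < 0") (auto intro!: divide_strict_right_mono)
    ultimately show ?thesis by (auto simp: pucci1_inv_def)
  qed
  then show ?thesis using \<open>y1 < y2\<close> by (simp add: slope_field_def)
qed

lemma tendsto_f: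
  "(a \<longlongrightarrow> x) F \<Longrightarrow> (b \<longlongrightarrow> y) F \<Longrightarrow> ((\<lambda>t. f (a t) (b t)) \<longlongrightarrow> f x y) F"
  unfolding slope_field_def pucci1_inv_def pucci1_def using lam_pos Lam_pos
  by (intro tendsto_intros) auto

lemma pucci1_minus_nonneg: "0 \<le> x \<Longrightarrow> pucci1 lam Lam (- x) = - lam * x"
  by (simp add: pucci1_def)

lemma pucci1_minus_nonpos: "x \<le> 0 \<Longrightarrow> pucci1 lam Lam (- x) = - Lam * x"
  by (simp add: pucci1_def)

text \<open>The hypotheses say that the profile is nonincreasing and convex, so \<open>U''\<close>
  carries the coefficient \<open>Lam\<close> and \<open>U' / r\<close> the coefficient
  \<open>lam\<close>.\<close>

lemma f_eq:
  assumes "0 \<le> x" "0 \<le> y - mu + n * lam * x"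
  shows "f x y = (y - P x) / Lam"
  using assms Lam_pos
  by (simp add: slope_field_def pucci1_inv_def pucci1_minus_nonneg P_expand field_simps)

text \<open>The quadratic term wins: \<open>x >= n\<close> absorbs \<open>n * x\<close> into
  \<open>x * x\<close>, and the rest of the threshold makes \<open>W / Lam - x\<close> at most
  \<open>- 1\<close>.\<close>

lemma f_upper:
  assumes "y \<le> W" "0 \<le> W" "1 + n + W / Lam \<le> x"
  shows "f x y \<le> - 1"
proof -
  have "0 \<le> W / Lam" using assms Lam_pos by simp
  then have x: "0 \<le> x" "n \<le> x" "1 + W / Lam \<le> x" using assms(3) n_gt_1 by linarith+
  have "max (y - mu - n * pucci1 lam Lam (- x)) 0 \<le> W + n * lam * x"
    using assms x n_gt_1 lam_pos mu_pos by (simp add: pucci1_minus_nonneg)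
  also have "\<dots> \<le> W + n * Lam * x"
    using x n_gt_1 lam_le by (intro add_left_mono mult_right_mono mult_left_mono) auto
  finally have "max (y - mu - n * pucci1 lam Lam (- x)) 0 / Lam \<le> (W + n * Lam * x) / Lam"
    using Lam_pos by (intro divide_right_mono) auto
  also have "\<dots> = W / Lam + n * x" using Lam_pos by (simp add: field_simps)
  finally have "f x y \<le> W / Lam + n * x - x - x * x" using f_le[of x y] by (simp add: power2_eq_square)
  moreover have "n * x \<le> x * x" using x by (intro mult_right_mono) auto
  ultimately show ?thesis using x by linarith
qed

text \<open>Below \<open>- (W / Lam)\<close> the argument of \<open>pucci1_inv\<close> is
  nonpositive, which leaves at most \<open>- x - x * x\<close>; then \<open>x <= - 2\<close> gives
  half of the square.\<close>

lemma f_lower: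
  assumes "y \<le> W" "0 \<le> W" "x \<le> - (W / Lam + 2)"
  shows "f x y \<le> - (x\<^sup>2 / 2)"
proof -
  have "0 \<le> W / Lam" using assms Lam_pos by simp
  then have "x \<le> 0" "x \<le> - 2" "x \<le> - (W / Lam)" using assms(3) by linarith+
  then have x: "x \<le> 0" "x \<le> - 2" "Lam * x \<le> - W"
    using Lam_pos by (simp_all add: field_simps)
  have "n * (Lam * x) \<le> 1 * (Lam * x)"
    using n_gt_1 x Lam_pos by (intro mult_right_mono_neg) (auto simp: mult_nonneg_nonpos)
  then have "max (y - mu - n * pucci1 lam Lam (- x)) 0 = 0"
    using assms x mu_pos by (simp add: pucci1_minus_nonpos)
  then have "f x y \<le> - x - x * x" using f_le[of x y] by (simp add: power2_eq_square)
  moreover have "x * (x + 2) \<ge> 0" using x by (intro mult_nonpos_nonpos) auto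
  ultimately show ?thesis by (simp add: algebra_simps power2_eq_square)
qed

text \<open>At a zero the value of \<open>pucci1_inv\<close> is \<open>m + m^2 > 0\<close>. Its
  argument is therefore positive, which puts the point strictly inside the convex region.\<close>

lemma f_zero_imp:
  assumes "f m y = 0" "0 < m"
  shows "y = P m" "0 < y - mu + n * lam * m"
proof -
  let ?s = "y - mu + n * lam * m"
  have "0 < m + m\<^sup>2" using \<open>0 < m\<close> by (simp add: add_pos_pos)
  also have "\<dots> = pucci1_inv lam Lam ?s"
    using assms by (simp add: slope_field_def pucci1_minus_nonneg mult.assoc)
  finally show s: "0 < ?s"
    using lam_pos by (cases "0 < ?s") (simp_all add: pucci1_inv_def zero_less_divide_iff)
  show "y = P m" using f_eq[of m y] s assms Lam_pos by simp
qed

text \<open>Excludes nonpositive limits of \<open>h\<close> when \<open>w\<close> tends to zero.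
  There the branch of \<open>pucci1_inv\<close> with \<open>lam\<close> is active, and
  \<open>lam <= Lam * n\<close> makes its value smaller than \<open>m\<close>.\<close>

lemma f_nonpos_neg: "m \<le> 0 \<Longrightarrow> f m 0 < 0"
proof -
  assume m: "m \<le> 0"
  have s: "n * Lam * m \<le> 0" using m n_gt_1 Lam_pos by (simp add: mult_nonneg_nonpos)
  have "lam * 1 \<le> Lam * n" using lam_le n_gt_1 Lam_pos lam_pos by (intro mult_mono) auto
  then have "(Lam * n) * m \<le> lam * m" using m by (intro mult_right_mono_neg) auto
  then have "n * Lam * m - mu < lam * m" using mu_pos by (simp add: mult.commute)
  then have "(n * Lam * m - mu) / lam < m" using lam_pos by (simp add: field_simps)
  moreover have "f m 0 = (n * Lam * m - mu) / lam - m - m\<^sup>2"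
    using s mu_pos m by (simp add: slope_field_def pucci1_inv_def pucci1_minus_nonpos max_def min_def)
  moreover have "0 \<le> m\<^sup>2" by simp
  ultimately show ?thesis by linarith
qed

section \<open>Eventual monotonicity and convergence of \<open>w\<close>\<close>

text \<open>Only interior times are constrained, because \<open>h = al\<close> at both ends of an
  excursion.\<close>

lemma w_strict_decreasing:
  assumes "0 < a" "a < b" "\<And>t. a < t \<Longrightarrow> t < b \<Longrightarrow> h t < al"
  shows "w b < w a"
proof (rule DERIV_neg_imp_decreasing_open[OF \<open>a < b\<close>])
  fix t assume "a < t" "t < b"
  then show "\<exists>y. (w has_real_derivative y) (at t) \<and> y < 0"
    using w_deriv[of t] assms p_gt_1 w_pos[of t]
    by (intro exI[of _ "(p - 1) * (h t - al) * w t"]) (auto simp: mult_pos_neg mult_neg_pos)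
next
  show "continuous_on {a..b} w"
    using \<open>0 < a\<close> by (intro continuous_on_Icc_if_deriv[OF w_deriv, of a]) auto
qed

text \<open>During an excursion of \<open>h\<close> below \<open>al\<close> the function \<open>w\<close> decreases, whereas \<open>f al\<close> increases
  with \<open>w\<close> and would have to be nonpositive at the exit and nonnegative at the return.\<close>
lemma no_return:
  assumes "0 < a" "a \<le> b" "al \<le> h a" "h b < al" "b \<le> c"
  shows "h c < al"
proof (rule ccontr)
  assume c: "\<not> h c < al"
  have cont: "continuous_on {x..y} (\<lambda>t. h t - al)" if "a \<le> x" for x y
    using that \<open>0 < a\<close> by (intro continuous_intros continuous_on_h) auto
  \<comment> \<open>The excursion is delimited by its exit time \<open>s\<close> and its return time
    \<open>q\<close>.\<close>
  obtain s where s: "a \<le> s" "s < b" "h s = al" "\<And>x. s < x \<Longrightarrow> x \<le> b \<Longrightarrow> h x < al"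
    using last_crossing[OF \<open>a \<le> b\<close> cont[of a]] assms by auto
  obtain q where q: "b < q" "q \<le> c" "h q = al" "\<And>x. b \<le> x \<Longrightarrow> x < q \<Longrightarrow> h x < al"
    using first_crossing[OF \<open>b \<le> c\<close> cont[of b]] assms c by auto
  have below: "h x < al" if "s < x" "x < q" for x
    using s(4) q(4) that by (cases "x \<le> b") auto
  have "w q < w s"
    using s q \<open>0 < a\<close> below by (intro w_strict_decreasing) auto
  then have less: "f al (w q) < f al (w s)" by (rule f_mono)
  have "f al (w s) \<le> 0"
  proof (rule ccontr)
    assume "\<not> f al (w s) \<le> 0"
    then obtain d where d: "d > 0" "\<And>k. 0 < k \<Longrightarrow> k < d \<Longrightarrow> h s < h (s + k)"
      using DERIV_pos_inc_right[OF h_deriv'[of s]] s \<open>0 < a\<close> by auto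
    define k where "k = min (d / 2) (b - s)"
    have "0 < k" "k < d" "s + k \<le> b" using d s by (auto simp: k_def)
    then show False using d(2)[of k] s(3) s(4)[of "s + k"] by auto
  qed
  then have "f al (w q) < 0" using less by simp
  then obtain d where d: "d > 0" "\<And>k. 0 < k \<Longrightarrow> k < d \<Longrightarrow> h q < h (q - k)"
    using DERIV_neg_dec_left[OF h_deriv'[of q]] s q \<open>0 < a\<close> by auto
  define k where "k = min (d / 2) (q - b)"
  have "0 < k" "k < d" "b \<le> q - k" using d q by (auto simp: k_def)
  then show False using d(2)[of k] q(3) q(4)[of "q - k"] by auto
qed

text \<open>One drop below \<open>al\<close> from a value at or above it is final by
  \<open>no_return\<close>. Without such a drop, \<open>h\<close> either reaches \<open>al\<close>
  and remains at or above it, or stays below forever.\<close>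

lemma eventually_one_side:
  "(\<forall>\<^sub>F t in at_top. al \<le> h t) \<or> (\<forall>\<^sub>F t in at_top. h t \<le> al)"
proof (cases "\<exists>a b. 0 < a \<and> a \<le> b \<and> al \<le> h a \<and> h b < al")
  case True
  then obtain a b where "0 < a" "a \<le> b" "al \<le> h a" "h b < al" by auto
  from no_return[OF this] have "\<forall>\<^sub>F t in at_top. h t \<le> al"
    by (auto simp: eventually_at_top_linorder intro: less_imp_le)
  then show ?thesis ..
next
  case False
  then have F: "\<And>a b. 0 < a \<Longrightarrow> a \<le> b \<Longrightarrow> al \<le> h a \<Longrightarrow> al \<le> h b" by (auto simp: not_less)
  show ?thesis
  proof (cases "\<exists>a>0. al \<le> h a")
    case True
    with F show ?thesis by (auto simp: eventually_at_top_linorder)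
  next
    case False
    then have "\<forall>t\<ge>1. h t \<le> al" by (auto simp: not_le less_imp_le)
    then show ?thesis by (auto simp: eventually_at_top_linorder)
  qed
qed

lemma eventually_w_deriv: "\<forall>\<^sub>F t in at_top. (w has_real_derivative (p - 1) * (h t - al) * w t) (at t)"
  using eventually_gt_at_top[of 0] by eventually_elim (rule w_deriv)

lemma eventually_h_deriv: "\<forall>\<^sub>F t in at_top. (h has_real_derivative f (h t) (w t)) (at t)"
  using eventually_gt_at_top[of 0] by eventually_elim (rule h_deriv')

lemma eventually_L_deriv:
  "\<forall>\<^sub>F t in at_top. ((\<lambda>t. L t - c * t) has_real_derivative h t - c) (at t)"
  using eventually_gt_at_top[of 0]
  by eventually_elim (auto intro!: derivative_eq_intros L_deriv)

text \<open>If \<open>w\<close> were unbounded, then \<open>h - c * sqrt w\<close> would become nonnegative for small \<open>c\<close>,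
  so that \<open>w\<close> would grow at least like \<open>w powr (3/2)\<close> and blow up in finite time
  (the Keller--Osserman bound).\<close>
lemma w_not_at_top:
  assumes h_ge: "\<forall>\<^sub>F t in at_top. al \<le> h t"
  shows "\<not> filterlim w at_top at_top"
proof
  assume w_top: "filterlim w at_top at_top"
  \<comment> \<open>The value is such that the losses from \<open>h^2\<close> and from
    \<open>c * e'\<close>, at most \<open>c^2 * (p + 1) / 2 * w\<close> together, consume exactly
    half of the gain \<open>w / Lam\<close>.\<close>
  define c where "c = sqrt (1 / (Lam * (p + 1)))"
  have c_pos: "0 < c" using Lam_pos p_gt_1 by (simp add: c_def)
  have c_sq: "c * c * (p + 1) = 1 / Lam"
    using Lam_pos p_gt_1 by (simp add: c_def)
  \<comment> \<open>This is the square root of \<open>w\<close>, written as an exponential to be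
    differentiated directly.\<close>
  define e where "e t = exp (((p - 1) * L t - 2 * t) / 2)" for t
  have e_sq: "e t * e t = w t" for t by (simp add: e_def w_def flip: exp_add)
  have e_pos: "0 < e t" for t by (simp add: e_def)
  define e' where "e' t = (p - 1) / 2 * (h t - al) * e t" for t
  have e_deriv: "(e has_real_derivative e' t) (at t)" if "0 < t" for t
    unfolding e_def e'_def using al_eq that
    by (auto intro!: derivative_eq_intros L_deriv simp: field_simps)
  \<comment> \<open>The first threshold yields \<open>y' >= 1\<close> wherever
    \<open>y <= 0\<close>, the second yields \<open>al <= c * e / 2\<close>.\<close>
  have "\<forall>\<^sub>F t in at_top. max (2 * mu + 2 * Lam) ((2 * al / c)\<^sup>2) \<le> w t \<and> al \<le> h t \<and> 0 < t"
    using w_top h_ge eventually_gt_at_top[of "0::real"]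
    unfolding filterlim_at_top by (auto simp: eventually_conj_iff)
  then obtain T where T: "\<And>t. T \<le> t \<Longrightarrow>
      2 * mu + 2 * Lam \<le> w t \<and> (2 * al / c)\<^sup>2 \<le> w t \<and> al \<le> h t \<and> 0 < t"
    unfolding eventually_at_top_linorder by auto
  define y where "y t = h t - c * e t" for t
  define y' where "y' t = f (h t) (w t) - c * e' t" for t
  have y_deriv: "(y has_real_derivative y' t) (at t)" if "T \<le> t" for t
    unfolding y_def y'_def using T[OF that]
    by (auto intro!: derivative_eq_intros h_deriv' e_deriv)
  have y'_ge: "1 \<le> y' t" if "T \<le> t" "y t \<le> 0" for t
  proof -
    note Tt = T[OF that(1)]
    have h: "0 < h t" "h t \<le> c * e t" using Tt al_pos that(2) by (auto simp: y_def)
    have "0 \<le> n * lam * h t" using h n_gt_1 lam_pos by simp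
    then have "f (h t) (w t) = (w t - P (h t)) / Lam"
      using h Tt mu_pos Lam_pos by (intro f_eq) auto
    moreover have "P (h t) \<le> Lam * (h t)\<^sup>2 + mu"
    proof -
      have "Lam \<le> lam * n" using tp_tm_sum Lam_pos tp_pos tm_pos
        by (smt (verit) mult_pos_pos)
      then have "Lam * h t \<le> lam * n * h t" using h by (intro mult_right_mono) auto
      then show ?thesis by (simp add: P_expand)
    qed
    ultimately have "(w t - (Lam * (h t)\<^sup>2 + mu)) / Lam \<le> f (h t) (w t)"
      using Lam_pos by (simp add: divide_right_mono)
    moreover have "(w t - (Lam * (h t)\<^sup>2 + mu)) / Lam = w t / Lam - h t * h t - mu / Lam"
      using Lam_pos by (simp add: field_simps power2_eq_square)
    ultimately have f: "w t / Lam - h t * h t - mu / Lam \<le> f (h t) (w t)" by simp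
    have hh: "h t * h t \<le> (c * e t) * (c * e t)" using h by (intro mult_mono) auto
    have "c * e' t \<le> c * ((p - 1) / 2 * (c * e t) * e t)"
      unfolding e'_def using c_pos p_gt_1 e_pos[of t] h al_pos
      by (intro mult_left_mono mult_right_mono) auto
    with f hh have "w t / Lam - (c * e t) * (c * e t) - mu / Lam - c * ((p - 1) / 2 * (c * e t) * e t) \<le> y' t"
      unfolding y'_def by linarith
    also have "w t / Lam - (c * e t) * (c * e t) - mu / Lam - c * ((p - 1) / 2 * (c * e t) * e t)
        = w t / Lam - mu / Lam - (c * c * (p + 1)) / 2 * (e t * e t)"
      by (simp add: field_simps)
    also have "\<dots> = (w t - 2 * mu) / (2 * Lam)"
      unfolding c_sq e_sq using Lam_pos by (simp add: field_simps)
    finally have "(w t - 2 * mu) / (2 * Lam) \<le> y' t" .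
    moreover have "1 \<le> (w t - 2 * mu) / (2 * Lam)" using Tt Lam_pos by (simp add: field_simps)
    ultimately show ?thesis by simp
  qed
  \<comment> \<open>While \<open>y\<close> is negative it grows at rate at least 1, so it reaches
    zero by the time \<open>T - y T\<close>.\<close>
  have "\<exists>a\<ge>T. 0 \<le> y a"
  proof (rule ccontr)
    assume "\<not> (\<exists>a\<ge>T. 0 \<le> y a)"
    then have neg: "\<And>t. T \<le> t \<Longrightarrow> y t < 0" by (meson not_le)
    define b where "b = T - y T"
    have "y T + 1 * (b - T) \<le> y b"
      using neg[of T] y'_ge neg
      by (intro deriv_ge_imp_ge_linear[of T y y']) (auto simp: b_def y_deriv less_imp_le)
    then show False using neg[of b] neg[of T] by (auto simp: b_def)
  qed
  then obtain a where a: "T \<le> a" "0 \<le> y a" by auto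
  have y_pos: "0 < y t" if "a < t" for t
  proof (rule barrier[of a y y', OF _ _ a(2) that])
    fix x assume "a \<le> x"
    then show "(y has_real_derivative y' x) (at x)" using a y_deriv by simp
    show "0 < y' x" if "y x = 0" using y'_ge[of x] \<open>a \<le> x\<close> a that by simp
  qed
  define k where "k = (p - 1) * c / 4"
  have k_pos: "0 < k" using p_gt_1 c_pos by (simp add: k_def)
  have e'_ge: "k \<le> e' t / (e t * e t)" if "a < t" for t
  proof -
    have "T \<le> t" using a that by simp
    note Tt = T[OF this]
    have "(2 * al / c)\<^sup>2 \<le> (e t)\<^sup>2" using Tt by (simp add: e_sq power2_eq_square[of "e t"])
    then have "2 * al / c \<le> e t" by (rule power2_le_imp_le) (simp add: less_imp_le e_pos)
    then have "al \<le> c * e t / 2" using c_pos by (simp add: field_simps)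
    then have "c * e t / 2 \<le> h t - al" using y_pos[OF that] by (simp add: y_def)
    then have "(p - 1) / 2 * (c * e t / 2) * e t \<le> e' t"
      unfolding e'_def using p_gt_1 e_pos[of t] by (intro mult_left_mono mult_right_mono) auto
    then show ?thesis using e_pos[of t] by (simp add: k_def field_simps)
  qed
  \<comment> \<open>Since \<open>e'\<close> is at least \<open>k * e^2\<close>, the negative
    function \<open>- 1 / e\<close> would grow at least linearly.\<close>
  have "filterlim (\<lambda>t. - inverse (e t)) at_top at_top"
  proof (rule filterlim_at_top_if_deriv_ge[OF _ _ k_pos])
    show "\<forall>\<^sub>F t in at_top. ((\<lambda>t. - inverse (e t)) has_real_derivative e' t / (e t * e t)) (at t)"
      using eventually_gt_at_top[of 0]
    proof eventually_elim
      case (elim t)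
      then show ?case using e_pos[of t]
        by (auto intro!: derivative_eq_intros e_deriv simp: divide_inverse)
    qed
    show "\<forall>\<^sub>F t in at_top. k \<le> e' t / (e t * e t)"
      using eventually_gt_at_top[of a] by eventually_elim (rule e'_ge)
  qed
  then have "\<forall>\<^sub>F t in at_top. 0 \<le> - inverse (e t)" unfolding filterlim_at_top ..
  then obtain t where "0 \<le> - inverse (e t)"
    using eventually_happens trivial_limit_at_top_linorder by blast
  then show False using e_pos[of t] by simp
qed

text \<open>The sign of \<open>h - al\<close> makes \<open>w\<close> eventually monotone. In the
  nondecreasing case, failure to tend to infinity already means boundedness.\<close>

lemma w_tendsto: obtains w0 where "0 \<le> w0" "(w \<longlongrightarrow> w0) at_top"
proof -
  have "\<exists>w0. (w \<longlongrightarrow> w0) at_top"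
    using eventually_one_side
  proof
    assume ge: "\<forall>\<^sub>F t in at_top. al \<le> h t"
    have nonneg: "\<forall>\<^sub>F t in at_top. 0 \<le> (p - 1) * (h t - al) * w t"
      using ge by eventually_elim (use p_gt_1 w_pos in \<open>auto simp: less_imp_le\<close>)
    obtain a where a: "\<And>t. a \<le> t \<Longrightarrow> (w has_real_derivative (p - 1) * (h t - al) * w t) (at t)
        \<and> 0 \<le> (p - 1) * (h t - al) * w t"
      using eventually_conj[OF eventually_w_deriv nonneg] by (auto simp: eventually_at_top_linorder)
    have mono: "w s \<le> w t" if "a \<le> s" "s \<le> t" for s t
      using a that by (intro DERIV_nonneg_imp_nondecreasing[of s t w]) (meson order_trans)+
    obtain B where "\<not> (\<forall>\<^sub>F t in at_top. B \<le> w t)"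
      using w_not_at_top[OF ge] by (auto simp: filterlim_at_top)
    then have B: "\<exists>s\<ge>t. w s < B" for t
      by (auto simp: eventually_at_top_linorder not_le)
    have "w t \<le> B" if "a \<le> t" for t
      using B[of t] mono[OF that] by force
    with mono show ?thesis by (rule mono_bounded_tendsto_at_top)
  next
    assume le: "\<forall>\<^sub>F t in at_top. h t \<le> al"
    have "\<exists>l. ((\<lambda>t. - w t) \<longlongrightarrow> l) at_top"
    proof (rule deriv_nonneg_bounded_tendsto_at_top)
      show "\<forall>\<^sub>F t in at_top. ((\<lambda>t. - w t) has_real_derivative - ((p - 1) * (h t - al) * w t)) (at t)"
        using eventually_w_deriv by eventually_elim (rule DERIV_minus)
      show "\<forall>\<^sub>F t in at_top. 0 \<le> - ((p - 1) * (h t - al) * w t)"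
        using le by eventually_elim
          (use p_gt_1 w_pos in \<open>auto simp: less_imp_le mult_nonneg_nonpos mult_nonpos_nonneg\<close>)
      show "\<forall>\<^sub>F t in at_top. - w t \<le> 0" by (simp add: w_pos less_imp_le)
    qed
    then obtain l where "((\<lambda>t. - w t) \<longlongrightarrow> l) at_top" by blast
    from tendsto_minus[OF this] show ?thesis by auto
  qed
  then obtain w0 where "(w \<longlongrightarrow> w0) at_top" by blast
  moreover from this have "0 \<le> w0"
    by (rule tendsto_lowerbound) (simp_all add: w_pos less_imp_le)
  ultimately show ?thesis using that by blast
qed

section \<open>Convergence of \<open>h\<close> and the possible limits\<close>

text \<open>Near the limit of \<open>w\<close> the field has a fixed sign on the line
  \<open>h = c\<close>, so this level can eventually be crossed in one direction only.\<close>

lemma eventually_h_side: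
  assumes w0: "(w \<longlongrightarrow> w0) at_top" and c: "f c w0 \<noteq> 0"
  shows "(\<forall>\<^sub>F t in at_top. c < h t) \<or> (\<forall>\<^sub>F t in at_top. h t \<le> c)"
proof -
  have lim: "((\<lambda>t. f c (w t)) \<longlongrightarrow> f c w0) at_top" by (rule tendsto_f[OF tendsto_const w0])
  from c consider "0 < f c w0" | "f c w0 < 0" by linarith
  then show ?thesis
  proof cases
    case 1
    then obtain T where T: "\<And>t. T \<le> t \<Longrightarrow> 0 < f c (w t) \<and> 0 < t"
      using eventually_conj[OF order_tendstoD(1)[OF lim] eventually_gt_at_top[of 0]]
      by (auto simp: eventually_at_top_linorder)
    have stay: "0 < h t - c" if "T \<le> a" "c \<le> h a" "a < t" for a t
      by (rule barrier[where g = "\<lambda>t. h t - c" and g' = "\<lambda>t. f (h t) (w t)" and a = a])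
        (use that T in \<open>auto intro!: derivative_eq_intros h_deriv'\<close>)
    show ?thesis
    proof (cases "\<exists>a\<ge>T. c < h a")
      case True
      then obtain a where "T \<le> a" "c < h a" by auto
      then have "\<forall>t>a. c < h t" using stay[of a] by auto
      then have "\<forall>\<^sub>F t in at_top. c < h t" unfolding eventually_at_top_dense ..
      then show ?thesis ..
    next
      case False
      then have "\<forall>t\<ge>T. h t \<le> c" by (meson not_less)
      then show ?thesis by (auto simp: eventually_at_top_linorder)
    qed
  next
    case 2
    then obtain T where T: "\<And>t. T \<le> t \<Longrightarrow> f c (w t) < 0 \<and> 0 < t"
      using eventually_conj[OF order_tendstoD(2)[OF lim] eventually_gt_at_top[of 0]]
      by (auto simp: eventually_at_top_linorder)
    have stay: "0 < c - h t" if "T \<le> a" "h a \<le> c" "a < t" for a t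
      by (rule barrier[where g = "\<lambda>t. c - h t" and g' = "\<lambda>t. - f (h t) (w t)" and a = a])
        (use that T in \<open>auto intro!: derivative_eq_intros h_deriv'\<close>)
    show ?thesis
    proof (cases "\<exists>a\<ge>T. h a \<le> c")
      case True
      then obtain a where "T \<le> a" "h a \<le> c" by auto
      then have "\<forall>t>a. h t \<le> c" using stay[of a] by (auto intro: less_imp_le)
      then have "\<forall>\<^sub>F t in at_top. h t \<le> c" unfolding eventually_at_top_dense ..
      then show ?thesis ..
    next
      case False
      then have "\<forall>t\<ge>T. c < h t" by (meson not_le)
      then show ?thesis by (auto simp: eventually_at_top_linorder)
    qed
  qed
qed

text \<open>Each choice of the active branches turns \<open>f c y = 0\<close> into a quadratic
  equation for \<open>c\<close>; there are at most four choices. Hence all but finitely many levels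
  are one-way.\<close>

lemma finite_f_zeros: "finite {c. f c y = 0}"
proof -
  define Q where "Q b d = {c::real. c\<^sup>2 = b * c + d}" for b d
  have fin: "finite (Q b d)" for b d
  proof (rule finite_subset)
    show "Q b d \<subseteq> {b / 2 + sqrt (b\<^sup>2 / 4 + d), b / 2 - sqrt (b\<^sup>2 / 4 + d)}"
    proof
      fix c assume "c \<in> Q b d"
      then have "(c - b / 2)\<^sup>2 = b\<^sup>2 / 4 + d" by (simp add: Q_def power2_eq_square algebra_simps)
      then have "\<bar>c - b / 2\<bar> = sqrt (b\<^sup>2 / 4 + d)" by (metis real_sqrt_abs)
      then show "c \<in> {b / 2 + sqrt (b\<^sup>2 / 4 + d), b / 2 - sqrt (b\<^sup>2 / 4 + d)}" by (auto simp: abs_if split: if_splits)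
    qed
  qed auto
  have "{c. f c y = 0} \<subseteq> (\<Union>a\<in>{lam, Lam}. \<Union>b\<in>{lam, Lam}. Q (n * b / a - 1) ((y - mu) / a))"
  proof
    fix c assume c: "c \<in> {c. f c y = 0}"
    obtain b where b: "b \<in> {lam, Lam}" "pucci1 lam Lam (- c) = - b * c"
      by (cases "0 \<le> c") (auto simp: pucci1_minus_nonneg pucci1_minus_nonpos)
    obtain a where a: "a \<in> {lam, Lam}" "pucci1_inv lam Lam (y - mu - n * pucci1 lam Lam (- c))
        = (y - mu - n * pucci1 lam Lam (- c)) / a"
      by (cases "0 \<le> y - mu - n * pucci1 lam Lam (- c)") (auto simp: pucci1_inv_def)
    have "(y - mu + n * b * c) / a = c + c\<^sup>2"
      using c a(2) by (simp add: slope_field_def b(2) mult.assoc)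
    then have "c\<^sup>2 = (y - mu + n * b * c) / a - c" by simp
    also have "\<dots> = (n * b / a - 1) * c + (y - mu) / a"
      by (simp add: add_divide_distrib left_diff_distrib)
    finally have "c \<in> Q (n * b / a - 1) ((y - mu) / a)" by (simp add: Q_def)
    with a b show "c \<in> (\<Union>a\<in>{lam, Lam}. \<Union>b\<in>{lam, Lam}. Q (n * b / a - 1) ((y - mu) / a))" by blast
  qed
  then show ?thesis by (rule finite_subset) (auto simp: fin)
qed

text \<open>Above this level \<open>h' <= - 1\<close>, which would drive \<open>h\<close> to minus
  infinity.\<close>

lemma h_not_above:
  assumes W: "\<forall>\<^sub>F t in at_top. w t \<le> W" "0 \<le> W"
  shows "\<not> (\<forall>\<^sub>F t in at_top. 1 + n + W / Lam < h t)"
proof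
  assume "\<forall>\<^sub>F t in at_top. 1 + n + W / Lam < h t"
  then have "\<forall>\<^sub>F t in at_top. 1 \<le> - f (h t) (w t)"
    using W(1) by eventually_elim (use f_upper[OF _ W(2)] in force)
  moreover have "\<forall>\<^sub>F t in at_top. ((\<lambda>t. - h t) has_real_derivative - f (h t) (w t)) (at t)"
    using eventually_h_deriv by eventually_elim (rule DERIV_minus)
  ultimately have "filterlim (\<lambda>t. - h t) at_top at_top"
    by (intro filterlim_at_top_if_deriv_ge[where c = 1]) auto
  then have "\<forall>\<^sub>F t in at_top. 0 \<le> - h t" unfolding filterlim_at_top ..
  with \<open>\<forall>\<^sub>F t in at_top. 1 + n + W / Lam < h t\<close> have "\<forall>\<^sub>F t :: real in at_top. False"
  proof eventually_elim
    case (elim t)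
    moreover have "0 \<le> W / Lam" using W Lam_pos by simp
    ultimately show ?case using n_gt_1 by linarith
  qed
  then show False by simp
qed

text \<open>Below this level \<open>h\<close> satisfies \<open>h' \<le> - h\<^sup>2 / 2\<close> and would reach minus infinity in finite time.\<close>
lemma h_not_below:
  assumes W: "\<forall>\<^sub>F t in at_top. w t \<le> W" "0 \<le> W"
  shows "\<not> (\<forall>\<^sub>F t in at_top. h t \<le> - (W / Lam + 2))"
proof
  assume low: "\<forall>\<^sub>F t in at_top. h t \<le> - (W / Lam + 2)"
  have neg: "\<forall>\<^sub>F t in at_top. h t < 0"
    using low
  proof eventually_elim
    case (elim t)
    moreover have "0 \<le> W / Lam" using W Lam_pos by simp
    ultimately show ?case by linarith
  qed
  \<comment> \<open>The derivative of \<open>1 / h\<close> is at least \<open>1 / 2\<close>,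
    although \<open>1 / h\<close> stays negative.\<close>
  have "\<forall>\<^sub>F t in at_top. 1 / 2 \<le> - f (h t) (w t) / (h t * h t)"
    using low W(1) neg
  proof eventually_elim
    case (elim t)
    then have "(h t)\<^sup>2 / 2 \<le> - f (h t) (w t)" using f_lower[OF _ W(2)] by force
    moreover have "0 < h t * h t" using elim by (simp add: mult_neg_neg)
    ultimately show ?case by (simp add: field_simps power2_eq_square)
  qed
  moreover have "\<forall>\<^sub>F t in at_top. ((\<lambda>t. inverse (h t)) has_real_derivative - f (h t) (w t) / (h t * h t)) (at t)"
    using eventually_h_deriv neg
    by eventually_elim (auto intro!: derivative_eq_intros simp: divide_inverse)
  ultimately have "filterlim (\<lambda>t. inverse (h t)) at_top at_top"
    by (intro filterlim_at_top_if_deriv_ge[where c = "1 / 2"]) auto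
  then have "\<forall>\<^sub>F t in at_top. 0 \<le> inverse (h t)" unfolding filterlim_at_top ..
  with neg have "\<forall>\<^sub>F t :: real in at_top. False" by eventually_elim auto
  then show False by simp
qed

text \<open>The limit is the supremum of the levels above which \<open>h\<close> eventually stays.
  The two preceding bounds make this set nonempty and bounded.\<close>

lemma h_tendsto:
  assumes w0: "(w \<longlongrightarrow> w0) at_top" "0 \<le> w0"
  obtains m where "(h \<longlongrightarrow> m) at_top" "f m w0 = 0"
proof -
  define W where "W = w0 + 1"
  have W: "\<forall>\<^sub>F t in at_top. w t \<le> W" "0 \<le> W"
    using order_tendstoD(2)[OF w0(1), of W] w0(2) by (auto simp: W_def elim: eventually_mono)
  define S where "S = {c. \<forall>\<^sub>F t in at_top. c < h t}"
  have "f (- (W / Lam + 2)) w0 \<le> - ((- (W / Lam + 2))\<^sup>2 / 2)"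
    by (rule f_lower) (use w0 Lam_pos in \<open>auto simp: W_def divide_right_mono\<close>)
  moreover have "0 \<le> W / Lam" using W(2) Lam_pos by simp
  ultimately have "f (- (W / Lam + 2)) w0 \<noteq> 0" by (auto simp: add_nonneg_eq_0_iff)
  then have "- (W / Lam + 2) \<in> S"
    using eventually_h_side[OF w0(1)] h_not_below[OF W] by (auto simp: S_def)
  moreover have bdd: "bdd_above S"
  proof (rule bdd_aboveI)
    fix c assume c: "c \<in> S"
    show "c \<le> 1 + n + W / Lam"
    proof (rule ccontr)
      assume "\<not> c \<le> 1 + n + W / Lam"
      with c have "\<forall>\<^sub>F t in at_top. 1 + n + W / Lam < h t"
        by (auto simp: S_def elim: eventually_mono)
      with h_not_above[OF W] show False by simp
    qed
  qed
  ultimately have S: "S \<noteq> {}" "bdd_above S" by auto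
  have h: "(h \<longlongrightarrow> Sup S) at_top"
  proof (rule order_tendstoI)
    fix c assume "c < Sup S"
    then obtain c' where "c' \<in> S" "c < c'" using less_cSup_iff[OF S] by auto
    then show "\<forall>\<^sub>F t in at_top. c < h t" by (auto simp: S_def elim: eventually_mono)
  next
    fix c assume "Sup S < c"
    \<comment> \<open>Between \<open>Sup S\<close> and \<open>c\<close> some level is not a zero of
      the field; as it is outside \<open>S\<close>, \<open>h\<close> is eventually below it.\<close>
    then have "infinite {Sup S<..<c}" by (simp add: infinite_Ioo)
    then have "\<not> {Sup S<..<c} \<subseteq> {c. f c w0 = 0}" using finite_f_zeros finite_subset by blast
    then have "\<exists>c'. Sup S < c' \<and> c' < c \<and> f c' w0 \<noteq> 0" by auto
    then obtain c' where c': "Sup S < c'" "c' < c" "f c' w0 \<noteq> 0" by blast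
    then have "c' \<notin> S" using cSup_upper[OF _ S(2), of c'] by auto
    then have "\<forall>\<^sub>F t in at_top. h t \<le> c'"
      using eventually_h_side[OF w0(1) c'(3)] by (auto simp: S_def)
    then show "\<forall>\<^sub>F t in at_top. h t < c" using c' by (auto elim: eventually_mono)
  qed
  moreover have "f (Sup S) w0 = 0"
    by (rule tendsto_deriv_imp_zero[OF h eventually_h_deriv tendsto_f[OF h w0(1)]])
  ultimately show ?thesis using that by blast
qed

lemma w_eq: "w t = exp ((p - 1) * (L t - al * t))"
  using al_eq by (simp add: w_def algebra_simps)

text \<open>In the last clause, \<open>m = al\<close> is forced if \<open>w\<close> has a positive
  limit, while \<open>m < al\<close> can occur only if \<open>w\<close> tends to zero.\<close>

lemma limit_cases:
  obtains m where "0 < m" "(h \<longlongrightarrow> m) at_top" "(w \<longlongrightarrow> P m) at_top"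
    "\<forall>\<^sub>F t in at_top. (h has_real_derivative (w t - P (h t)) / Lam) (at t)"
    "m = al \<and> 0 \<le> P m \<or> m < al \<and> P m = 0"
proof -
  obtain w0 where w0: "0 \<le> w0" "(w \<longlongrightarrow> w0) at_top" by (rule w_tendsto)
  obtain m where m: "(h \<longlongrightarrow> m) at_top" "f m w0 = 0" by (rule h_tendsto[OF w0(2,1)])
  \<comment> \<open>Here \<open>L t - al * t\<close>, a multiple of \<open>ln (w t)\<close>,
    converges, so the limit of its derivative \<open>h - al\<close> is zero.\<close>
  have "m = al" if "0 < w0"
  proof -
    have "((\<lambda>t. ln (w t) / (p - 1)) \<longlongrightarrow> ln w0 / (p - 1)) at_top"
      using w0 that p_gt_1 by (intro tendsto_intros) auto
    then have lim: "((\<lambda>t. L t - al * t) \<longlongrightarrow> ln w0 / (p - 1)) at_top"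
      using p_gt_1 by (simp add: w_eq)
    have "((\<lambda>t. h t - al) \<longlongrightarrow> m - al) at_top" by (intro tendsto_intros m)
    from tendsto_deriv_imp_zero[OF lim eventually_L_deriv this] show "m = al" by simp
  qed
  \<comment> \<open>If \<open>m > al\<close>, then \<open>L t - al * t\<close> grows linearly and
    \<open>w\<close> cannot tend to zero.\<close>
  moreover have "m \<le> al" if "w0 = 0"
  proof (rule ccontr)
    assume "\<not> m \<le> al"
    then have "(al + m) / 2 < m" "0 < (m - al) / 2" by auto
    have "\<forall>\<^sub>F t in at_top. (m - al) / 2 \<le> h t - al"
      using order_tendstoD(1)[OF m(1) \<open>(al + m) / 2 < m\<close>]
      by eventually_elim (simp add: field_simps)
    from filterlim_at_top_if_deriv_ge[OF eventually_L_deriv this \<open>0 < (m - al) / 2\<close>]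
    have "\<forall>\<^sub>F t in at_top. 0 \<le> L t - al * t" unfolding filterlim_at_top ..
    then have "\<forall>\<^sub>F t in at_top. 1 \<le> w t"
      by eventually_elim (use p_gt_1 in \<open>simp add: w_eq\<close>)
    from tendsto_lowerbound[OF w0(2) this] that show False by simp
  qed
  moreover have "0 < m"
  proof (rule ccontr)
    assume "\<not> 0 < m"
    then have "w0 = 0" using \<open>0 < w0 \<Longrightarrow> m = al\<close> al_pos w0(1) by fastforce
    then show False using f_nonpos_neg[of m] m \<open>\<not> 0 < m\<close> by auto
  qed
  moreover note z = f_zero_imp[OF m(2) \<open>0 < m\<close>]
  \<comment> \<open>Both conditions for the quadratic form of \<open>f\<close> hold strictly at the
    limit, hence for all large times.\<close>
  moreover have "\<forall>\<^sub>F t in at_top. (h has_real_derivative (w t - P (h t)) / Lam) (at t)"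
  proof -
    have "((\<lambda>t. w t - mu + n * lam * h t) \<longlongrightarrow> w0 - mu + n * lam * m) at_top"
      by (intro tendsto_intros w0 m)
    from order_tendstoD(1)[OF this z(2)] order_tendstoD(1)[OF m(1) \<open>0 < m\<close>] eventually_h_deriv
    show ?thesis by eventually_elim (simp add: f_eq)
  qed
  ultimately show ?thesis
    using that[of m] m w0 by (cases "w0 = 0") (auto simp: less_le)
qed

subsection \<open>Asymptotics near the rest points\<close>



definition dh :: "real \<Rightarrow> real" where "dh t = w t / Lam - (h t - tp) * (h t - tm)"

lemma dh_eq: "(w t - P (h t)) / Lam = dh t"
  using Lam_pos by (simp add: dh_def P_def diff_divide_distrib)

section \<open>Rest points with \<open>w = 0\<close>\<close>

text \<open>Giving away half of the gap \<open>al - m\<close> leaves a constant exponential rate of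
  decay, so a multiple of \<open>w\<close> can absorb the source term \<open>w / Lam\<close> in
  \<open>dh\<close>.\<close>

lemma w_decay:
  assumes "(h \<longlongrightarrow> m) at_top" "m < al"
  shows "\<forall>\<^sub>F t in at_top. (p - 1) * (h t - al) * w t \<le> - ((p - 1) * (al - m) / 2) * w t"
proof -
  have "m < (al + m) / 2" using assms(2) by simp
  from order_tendstoD(2)[OF assms(1) this] show ?thesis
  proof eventually_elim
    case (elim t)
    then have "(p - 1) * (h t - al) \<le> (p - 1) * (- (al - m) / 2)"
      using p_gt_1 by (intro mult_left_mono) auto
    also have "\<dots> = - ((p - 1) * (al - m) / 2)" by (simp add: field_simps)
    finally show ?case by (rule mult_right_mono) (simp add: w_pos less_imp_le)
  qed
qed

text \<open>The function \<open>l = L - tp * t\<close> has derivative \<open>h - tp\<close>, which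
  is eventually of one sign, so \<open>l\<close> only has to be bounded. Because \<open>dh\<close>
  contains \<open>- (h - tp) * (h - tm)\<close> with \<open>h - tm >= s\<close>, the growth of
  \<open>l\<close> is controlled by that of \<open>h\<close>.\<close>

lemma tendsto_tp:
  assumes h: "(h \<longlongrightarrow> tp) at_top" and w: "(w \<longlongrightarrow> 0) at_top" and "tp \<le> al"
    and deriv: "\<forall>\<^sub>F t in at_top. (h has_real_derivative dh t) (at t)"
  shows "tp < al" "\<exists>c. ((\<lambda>t. L t - tp * t) \<longlongrightarrow> c) at_top"
proof -
  define s where "s = (tp - tm) / 2"
  have s: "0 < s" "tp - s = tm + s" using tm_less_tp by (auto simp: s_def field_simps)
  have gap: "\<forall>\<^sub>F t in at_top. s \<le> h t - tm"
    using order_tendstoD(1)[OF h, of "tp - s"] s by (auto elim: eventually_mono)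
  define l where "l t = L t - tp * t" for t
  have l_deriv: "\<forall>\<^sub>F t in at_top. (l has_real_derivative h t - tp) (at t)"
    unfolding l_def by (rule eventually_L_deriv)
  consider "\<forall>\<^sub>F t in at_top. h t \<le> tp" | "\<forall>\<^sub>F t in at_top. tp < h t"
  proof -
    obtain T where T: "\<And>t. T \<le> t \<Longrightarrow> (h has_real_derivative dh t) (at t)"
      using deriv by (auto simp: eventually_at_top_linorder)
    show ?thesis
    proof (cases "\<exists>a\<ge>T. tp < h a")
      case True
      then obtain a where a: "T \<le> a" "tp < h a" by blast
      \<comment> \<open>On the line \<open>h = tp\<close> the derivative is
        \<open>w / Lam > 0\<close>, so \<open>h\<close> cannot come back from above.\<close>
      have "0 < h t - tp" if "a < t" for t
        by (rule barrier[where g = "\<lambda>t. h t - tp" and g' = dh and a = a])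
          (use a T that w_pos Lam_pos in \<open>auto intro!: derivative_eq_intros simp: dh_def\<close>)
      then have "\<forall>t>a. tp < h t" by auto
      then have "\<forall>\<^sub>F t in at_top. tp < h t" unfolding eventually_at_top_dense ..
      then show ?thesis by (rule that(2))
    next
      case False
      then have "\<forall>t\<ge>T. h t \<le> tp" by (meson not_le)
      then have "\<forall>\<^sub>F t in at_top. h t \<le> tp" unfolding eventually_at_top_linorder ..
      then show ?thesis by (rule that(1))
    qed
  qed
  then have "tp < al \<and> (\<exists>c. (l \<longlongrightarrow> c) at_top)"
  proof cases
    case 1
    \<comment> \<open>The derivative of \<open>G\<close> is
      \<open>(h - tp) * (h - tm - s) - w / Lam\<close>, a sum of nonpositive terms.\<close>
    define G where "G t = - (s * l t + h t)" for t
    have "\<forall>\<^sub>F t in at_top. (G has_real_derivative - (s * (h t - tp) + dh t)) (at t)"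
      using deriv l_deriv unfolding G_def
      by eventually_elim (auto intro!: derivative_eq_intros)
    moreover have "\<forall>\<^sub>F t in at_top. - (s * (h t - tp) + dh t) \<le> 0"
      using gap 1
    proof eventually_elim
      case (elim t)
      have "(h t - tp) * (h t - tm - s) \<le> 0" using elim by (intro mult_nonpos_nonneg) auto
      moreover have "0 < w t / Lam" using w_pos Lam_pos by simp
      ultimately show ?case by (simp add: dh_def algebra_simps)
    qed
    ultimately obtain B where "\<forall>\<^sub>F t in at_top. G t \<le> B" by (rule eventually_bounded_if_deriv_nonpos)
    then have bound: "\<forall>\<^sub>F t in at_top. - l t \<le> (B + tp) / s"
      using 1 by eventually_elim (use s in \<open>auto simp: G_def field_simps\<close>)
    have "\<exists>c. ((\<lambda>t. - l t) \<longlongrightarrow> c) at_top"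
    proof (rule deriv_nonneg_bounded_tendsto_at_top[OF _ _ bound])
      show "\<forall>\<^sub>F t in at_top. ((\<lambda>t. - l t) has_real_derivative - (h t - tp)) (at t)"
        using l_deriv by eventually_elim (rule DERIV_minus)
      show "\<forall>\<^sub>F t in at_top. 0 \<le> - (h t - tp)" using 1 by eventually_elim simp
    qed
    then obtain c where "((\<lambda>t. - l t) \<longlongrightarrow> c) at_top" ..
    from tendsto_minus[OF this] have c: "(l \<longlongrightarrow> - c) at_top" by simp
    \<comment> \<open>If \<open>tp = al\<close>, then \<open>w\<close> is
      \<open>exp ((p - 1) * l)\<close>, whose limit would be positive.\<close>
    moreover have "tp \<noteq> al"
    proof
      assume "tp = al"
      then have "w = (\<lambda>t. exp ((p - 1) * l t))" by (auto simp: w_eq l_def)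
      moreover have "((\<lambda>t. exp ((p - 1) * l t)) \<longlongrightarrow> exp ((p - 1) * - c)) at_top"
        by (intro tendsto_intros c)
      ultimately have "exp ((p - 1) * - c) = 0"
        using tendsto_unique[OF trivial_limit_at_top_linorder _ w] by metis
      then show False using exp_not_eq_zero by blast
    qed
    ultimately show ?thesis using \<open>tp \<le> al\<close> by auto
  next
    case 2
    \<comment> \<open>If \<open>tp = al\<close>, then \<open>h > al\<close> makes the positive
      function \<open>w\<close> increase, so it cannot tend to zero.\<close>
    have "tp \<noteq> al"
    proof
      assume "tp = al"
      have "\<forall>\<^sub>F t in at_top. w t > 0 \<longrightarrow> (p - 1) * (h t - al) * w t > 0"
        using 2 by eventually_elim (use p_gt_1 \<open>tp = al\<close> in auto)
      from repelled_tendsto_zero_nonpos[OF w eventually_w_deriv this]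
      have "\<forall>\<^sub>F t :: real in at_top. False" by eventually_elim (use w_pos in \<open>auto simp: not_le[symmetric]\<close>)
      then show False by simp
    qed
    then have "tp < al" using \<open>tp \<le> al\<close> by simp
    define b where "b = (p - 1) * (al - tp) / 2"
    have b: "0 < b" using p_gt_1 \<open>tp < al\<close> by (simp add: b_def)
    \<comment> \<open>The derivative of the last summand is at most \<open>- w / Lam\<close> and
      cancels the source term in \<open>dh\<close>.\<close>
    define G where "G t = s * l t + h t + w t / (Lam * b)" for t
    let ?w' = "\<lambda>t. (p - 1) * (h t - al) * w t"
    have "\<forall>\<^sub>F t in at_top. (G has_real_derivative s * (h t - tp) + dh t + ?w' t / (Lam * b)) (at t)"
      using deriv l_deriv eventually_w_deriv unfolding G_def
      by eventually_elim (use b Lam_pos in \<open>auto intro!: derivative_eq_intros\<close>)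
    moreover have "\<forall>\<^sub>F t in at_top. s * (h t - tp) + dh t + ?w' t / (Lam * b) \<le> 0"
      using gap 2 w_decay[OF h \<open>tp < al\<close>]
    proof eventually_elim
      case (elim t)
      have "0 \<le> (h t - tp) * (h t - tm - s)" using elim by (intro mult_nonneg_nonneg) auto
      moreover have "?w' t / (Lam * b) \<le> (- b * w t) / (Lam * b)"
        using elim b Lam_pos by (intro divide_right_mono) (auto simp: b_def)
      moreover have "(- b * w t) / (Lam * b) = - (w t / Lam)" using b by simp
      ultimately show ?case by (simp add: dh_def algebra_simps)
    qed
    ultimately obtain B where "\<forall>\<^sub>F t in at_top. G t \<le> B" by (rule eventually_bounded_if_deriv_nonpos)
    then have bound: "\<forall>\<^sub>F t in at_top. l t \<le> B / s"
      using 2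
    proof eventually_elim
      case (elim t)
      have "0 < w t / (Lam * b)" using w_pos Lam_pos b by simp
      then have "s * l t \<le> B" using elim tp_pos unfolding G_def by linarith
      then show ?case using s by (simp add: field_simps)
    qed
    have "\<forall>\<^sub>F t in at_top. 0 \<le> h t - tp" using 2 by eventually_elim simp
    from deriv_nonneg_bounded_tendsto_at_top[OF l_deriv this bound] \<open>tp < al\<close> show ?thesis by simp
  qed
  then show "tp < al" "\<exists>c. ((\<lambda>t. L t - tp * t) \<longlongrightarrow> c) at_top" by (auto simp: l_def[abs_def])
qed

text \<open>The direction of \<open>h\<close> is unstable at \<open>tm\<close>: between
  \<open>tm\<close> and \<open>tp\<close> both terms of \<open>dh\<close> are positive.\<close>

lemma eventually_h_le_tm:
  assumes h: "(h \<longlongrightarrow> tm) at_top"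
    and deriv: "\<forall>\<^sub>F t in at_top. (h has_real_derivative dh t) (at t)"
  shows "\<forall>\<^sub>F t in at_top. h t \<le> tm"
proof -
  have "((\<lambda>t. h t - tm) \<longlongrightarrow> 0) at_top" using tendsto_diff[OF h tendsto_const[of tm]] by simp
  moreover have "\<forall>\<^sub>F t in at_top. ((\<lambda>t. h t - tm) has_real_derivative dh t) (at t)"
    using deriv by eventually_elim (auto intro!: derivative_eq_intros)
  moreover have "\<forall>\<^sub>F t in at_top. h t - tm > 0 \<longrightarrow> dh t > 0"
    using order_tendstoD(2)[OF h tm_less_tp]
  proof eventually_elim
    case (elim t)
    have "0 < w t / Lam" using w_pos Lam_pos by simp
    then show ?case using mult_neg_pos[of "h t - tp" "h t - tm"] elim by (auto simp: dh_def)
  qed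
  ultimately have "\<forall>\<^sub>F t in at_top. h t - tm \<le> 0" by (rule repelled_tendsto_zero_nonpos)
  then show ?thesis by simp
qed

text \<open>The argument for \<open>tp\<close> with \<open>h <= tm\<close>: now
  \<open>- (L - tm * t)\<close> is nondecreasing, and \<open>tp - h >= s\<close> supplies the
  coercive factor.\<close>

lemma tendsto_tm:
  assumes h: "(h \<longlongrightarrow> tm) at_top" and "tm < al"
    and deriv: "\<forall>\<^sub>F t in at_top. (h has_real_derivative dh t) (at t)"
  shows "\<exists>c. ((\<lambda>t. L t - tm * t) \<longlongrightarrow> c) at_top"
proof -
  define s where "s = (tp - tm) / 2"
  have s: "0 < s" "tp - s = tm + s" using tm_less_tp by (auto simp: s_def field_simps)
  have gap: "\<forall>\<^sub>F t in at_top. s \<le> tp - h t"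
    using order_tendstoD(2)[OF h, of "tp - s"] s by (auto elim: eventually_mono)
  note nonpos = eventually_h_le_tm[OF h deriv]
  define l where "l t = L t - tm * t" for t
  have l_deriv: "\<forall>\<^sub>F t in at_top. (l has_real_derivative h t - tm) (at t)"
    unfolding l_def by (rule eventually_L_deriv)
  define b where "b = (p - 1) * (al - tm) / 2"
  have b: "0 < b" using p_gt_1 \<open>tm < al\<close> by (simp add: b_def)
  define G where "G t = - (s * l t) + h t + w t / (Lam * b)" for t
  let ?w' = "\<lambda>t. (p - 1) * (h t - al) * w t"
  have "\<forall>\<^sub>F t in at_top. (G has_real_derivative - (s * (h t - tm)) + dh t + ?w' t / (Lam * b)) (at t)"
    using deriv l_deriv eventually_w_deriv unfolding G_def
    by eventually_elim (use b Lam_pos in \<open>auto intro!: derivative_eq_intros\<close>)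
  moreover have "\<forall>\<^sub>F t in at_top. - (s * (h t - tm)) + dh t + ?w' t / (Lam * b) \<le> 0"
    using gap nonpos w_decay[OF h \<open>tm < al\<close>]
  proof eventually_elim
    case (elim t)
    have "(h t - tm) * (tp - h t - s) \<le> 0" using elim by (intro mult_nonpos_nonneg) auto
    moreover have "?w' t / (Lam * b) \<le> (- b * w t) / (Lam * b)"
      using elim b Lam_pos by (intro divide_right_mono) (auto simp: b_def)
    moreover have "(- b * w t) / (Lam * b) = - (w t / Lam)" using b by simp
    ultimately show ?case by (simp add: dh_def algebra_simps)
  qed
  ultimately obtain B where "\<forall>\<^sub>F t in at_top. G t \<le> B" by (rule eventually_bounded_if_deriv_nonpos)
  then have bound: "\<forall>\<^sub>F t in at_top. - l t \<le> B / s"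
    using order_tendstoD(1)[OF h tm_pos]
  proof eventually_elim
    case (elim t)
    have "0 < w t / (Lam * b)" using w_pos Lam_pos b by simp
    then have "- (s * l t) \<le> B" using elim unfolding G_def by linarith
    then show ?case using s by (simp add: field_simps)
  qed
  have "\<exists>c. ((\<lambda>t. - l t) \<longlongrightarrow> c) at_top"
  proof (rule deriv_nonneg_bounded_tendsto_at_top[OF _ _ bound])
    show "\<forall>\<^sub>F t in at_top. ((\<lambda>t. - l t) has_real_derivative - (h t - tm)) (at t)"
      using l_deriv by eventually_elim (rule DERIV_minus)
    show "\<forall>\<^sub>F t in at_top. 0 \<le> - (h t - tm)" using nonpos by eventually_elim simp
  qed
  then obtain c where "((\<lambda>t. - l t) \<longlongrightarrow> c) at_top" ..
  from tendsto_minus[OF this] show ?thesis by (auto simp: l_def)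
qed

text \<open>For \<open>al = tm\<close> the trajectory follows the center manifold \<open>h - tm \<approx> - w / (Lam * (tp - tm))\<close>.\<close>
lemma center_manifold:
  assumes h: "(h \<longlongrightarrow> tm) at_top" and w: "(w \<longlongrightarrow> 0) at_top" and "al = tm"
    and deriv: "\<forall>\<^sub>F t in at_top. (h has_real_derivative dh t) (at t)"
  shows "((\<lambda>t. (h t - tm) / w t) \<longlongrightarrow> - (1 / (Lam * (tp - tm)))) at_top"
proof -
  \<comment> \<open>The deviation from the line \<open>h - tm = - k * w\<close>. It satisfies
    \<open>y' = (tp - h) * y + c * w\<close>, so the sign of the limit of \<open>c\<close> decides
    on which side of the line the trajectory must end.\<close>
  define y where "y k t = h t - tm + k * w t" for k t
  define c where "c k t = 1 / Lam - k * (tp - h t) + k * (p - 1) * (h t - tm)" for k t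
  have y0: "(y k \<longlongrightarrow> 0) at_top" for k
    unfolding y_def using tendsto_add[OF tendsto_diff[OF h tendsto_const[of tm]] tendsto_mult_right_zero[OF w, of k]]
    by simp
  have y_deriv: "\<forall>\<^sub>F t in at_top. (y k has_real_derivative (tp - h t) * y k t + c k t * w t) (at t)" for k
    using deriv eventually_w_deriv
  proof eventually_elim
    case (elim t)
    have "(y k has_real_derivative dh t + k * ((p - 1) * (h t - al) * w t)) (at t)"
      unfolding y_def using elim by (auto intro!: derivative_eq_intros)
    also have "dh t + k * ((p - 1) * (h t - al) * w t) = (tp - h t) * y k t + c k t * w t"
      by (simp add: dh_def y_def c_def \<open>al = tm\<close> algebra_simps)
    finally show ?case .
  qed
  have "(c k \<longlongrightarrow> 1 / Lam - k * (tp - tm) + k * (p - 1) * (tm - tm)) at_top" for k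
    unfolding c_def by (intro tendsto_intros h)
  then have c_lim: "(c k \<longlongrightarrow> 1 / Lam - k * (tp - tm)) at_top" for k by simp
  have tp: "\<forall>\<^sub>F t in at_top. h t < tp" by (rule order_tendstoD(2)[OF h tm_less_tp])
  \<comment> \<open>For such \<open>k\<close> the coefficient \<open>c\<close> is eventually
    positive and a positive \<open>y\<close> would grow. Larger \<open>k\<close> give the reversed
    sign, which squeezes the quotient.\<close>
  have small: "\<forall>\<^sub>F t in at_top. y k t \<le> 0" if "k < 1 / (Lam * (tp - tm))" for k
  proof (rule repelled_tendsto_zero_nonpos[OF y0 y_deriv])
    have "0 < 1 / Lam - k * (tp - tm)" using that Lam_pos tm_less_tp by (simp add: field_simps)
    from order_tendstoD(1)[OF c_lim this] tp
    show "\<forall>\<^sub>F t in at_top. y k t > 0 \<longrightarrow> (tp - h t) * y k t + c k t * w t > 0"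
      by eventually_elim (use w_pos in \<open>auto intro!: add_pos_pos\<close>)
  qed
  have large: "\<forall>\<^sub>F t in at_top. 0 \<le> y k t" if "1 / (Lam * (tp - tm)) < k" for k
  proof -
    have "1 / Lam - k * (tp - tm) < 0" using that Lam_pos tm_less_tp by (simp add: field_simps)
    from order_tendstoD(2)[OF c_lim this] tp
    have "\<forall>\<^sub>F t in at_top. - y k t > 0 \<longrightarrow> - ((tp - h t) * y k t + c k t * w t) > 0"
    proof eventually_elim
      case (elim t)
      show ?case
      proof
        assume "- y k t > 0"
        then have "(tp - h t) * y k t < 0" using elim by (intro mult_pos_neg) auto
        moreover have "c k t * w t < 0" using elim w_pos by (intro mult_neg_pos) auto
        ultimately show "- ((tp - h t) * y k t + c k t * w t) > 0" by linarith
      qed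
    qed
    moreover have "\<forall>\<^sub>F t in at_top. ((\<lambda>t. - y k t) has_real_derivative - ((tp - h t) * y k t + c k t * w t)) (at t)"
      using y_deriv[of k] by eventually_elim (rule DERIV_minus)
    moreover have "((\<lambda>t. - y k t) \<longlongrightarrow> 0) at_top" using tendsto_minus[OF y0[of k]] by simp
    ultimately have "\<forall>\<^sub>F t in at_top. - y k t \<le> 0" by (intro repelled_tendsto_zero_nonpos)
    then show ?thesis by simp
  qed
  have q: "(h t - tm) / w t = y k t / w t - k" for k t
    using w_pos[of t] by (simp add: y_def field_simps)
  show ?thesis
  proof (rule order_tendstoI)
    fix x assume "x < - (1 / (Lam * (tp - tm)))"
    then have "1 / (Lam * (tp - tm)) < - x" by simp
    then obtain k where k: "1 / (Lam * (tp - tm)) < k" "k < - x" using dense by blast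
    show "\<forall>\<^sub>F t in at_top. x < (h t - tm) / w t"
      using large[OF k(1)]
    proof eventually_elim
      case (elim t)
      then have "0 \<le> y k t / w t" using w_pos[of t] by simp
      then show ?case unfolding q[of t k] using k by simp
    qed
  next
    fix x assume "- (1 / (Lam * (tp - tm))) < x"
    then have "- x < 1 / (Lam * (tp - tm))" by simp
    then obtain k where k: "- x < k" "k < 1 / (Lam * (tp - tm))" using dense by blast
    show "\<forall>\<^sub>F t in at_top. (h t - tm) / w t < x"
      using small[OF k(2)]
    proof eventually_elim
      case (elim t)
      then have "y k t / w t \<le> 0" using w_pos[of t] by (simp add: divide_nonpos_pos)
      then show ?case unfolding q[of t k] using k by simp
    qed
  qed
qed

text \<open>The derivative of \<open>1 / w\<close> is \<open>- (p - 1) * (h - tm) / w\<close>, whose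
  limit is known from the center manifold; L'Hospital's rule then gives the limit of
  \<open>1 / (w * t)\<close>.\<close>

lemma tendsto_critical:
  assumes h: "(h \<longlongrightarrow> tm) at_top" and w: "(w \<longlongrightarrow> 0) at_top" and "al = tm"
    and deriv: "\<forall>\<^sub>F t in at_top. (h has_real_derivative dh t) (at t)"
  shows "((\<lambda>t. w t * t) \<longlongrightarrow> Lam * tm * ((tp - tm) / 2)) at_top"
proof -
  have "((\<lambda>t. inverse (w t) / t) \<longlongrightarrow> (p - 1) / (Lam * (tp - tm))) at_top"
  proof (rule lhospital_at_top_at_top)
    show "LIM t at_top. (t :: real) :> at_top" by (rule filterlim_ident)
    show "\<forall>\<^sub>F t :: real in at_top. (1 :: real) \<noteq> 0" by simp
    show "\<forall>\<^sub>F t in at_top. ((\<lambda>t. inverse (w t)) has_real_derivative - (p - 1) * ((h t - tm) / w t)) (at t)"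
      using eventually_w_deriv
    proof eventually_elim
      case (elim t)
      then show ?case using w_pos[of t]
        by (auto intro!: derivative_eq_intros simp: \<open>al = tm\<close> field_simps)
    qed
    show "\<forall>\<^sub>F t in at_top. ((\<lambda>t. t) has_real_derivative 1) (at t)" by simp
    have "- (p - 1) * - (1 / (Lam * (tp - tm))) = (p - 1) / (Lam * (tp - tm))"
      unfolding minus_mult_minus by simp
    with tendsto_mult[OF tendsto_const[of "- (p - 1)"] center_manifold[OF assms]]
    show "((\<lambda>t. - (p - 1) * ((h t - tm) / w t) / 1) \<longlongrightarrow> (p - 1) / (Lam * (tp - tm))) at_top"
      by (simp only: div_by_1)
  qed
  then have "((\<lambda>t. inverse (inverse (w t) / t)) \<longlongrightarrow> inverse ((p - 1) / (Lam * (tp - tm)))) at_top"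
    by (rule tendsto_inverse) (use p_gt_1 Lam_pos tm_less_tp in auto)
  moreover have "inverse ((p - 1) / (Lam * (tp - tm))) = Lam * tm * ((tp - tm) / 2)"
  proof -
    have "tm / 2 = inverse (p - 1)" using p_gt_1 by (simp add: al_def field_simps flip: \<open>al = tm\<close>)
    moreover have "Lam * tm * ((tp - tm) / 2) = Lam * (tp - tm) * (tm / 2)" by simp
    ultimately show ?thesis by (simp only: divide_inverse inverse_mult_distrib inverse_inverse_eq ac_simps)
  qed
  moreover have "inverse (inverse (w t) / t) = w t * t" for t by (simp add: divide_inverse)
  ultimately show ?thesis by (simp only:)
qed

section \<open>The asymptotic regimes according to the position of \<open>al\<close>\<close>

lemma P_zero_iff: "P m = 0 \<longleftrightarrow> m = tp \<or> m = tm"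
  using Lam_pos by (auto simp: P_def)

lemma asymptotics_subcritical:
  assumes "tp < al"
  shows "(w \<longlongrightarrow> P al) at_top \<or> (\<exists>c. ((\<lambda>t. L t - tp * t) \<longlongrightarrow> c) at_top)
    \<or> (\<exists>c. ((\<lambda>t. L t - tm * t) \<longlongrightarrow> c) at_top)"
proof -
  obtain m where m: "(h \<longlongrightarrow> m) at_top" "(w \<longlongrightarrow> P m) at_top"
    "\<forall>\<^sub>F t in at_top. (h has_real_derivative dh t) (at t)"
    "m = al \<and> 0 \<le> P m \<or> m < al \<and> P m = 0"
    using limit_cases unfolding dh_eq by blast
  from m(4) show ?thesis
  proof (elim disjE conjE)
    assume "m = al" then show ?thesis using m(2) by simp
  next
    assume "m < al" "P m = 0"
    then consider "m = tp" | "m = tm" by (auto simp: P_zero_iff)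
    then show ?thesis
    proof cases
      case 1
      then show ?thesis using tendsto_tp(2) m \<open>P m = 0\<close> assms by auto
    next
      case 2
      then show ?thesis using tendsto_tm m \<open>m < al\<close> by auto
    qed
  qed
qed

lemma asymptotics_intermediate:
  assumes "tm < al" "al \<le> tp"
  shows "\<exists>c. ((\<lambda>t. L t - tm * t) \<longlongrightarrow> c) at_top"
proof -
  obtain m where m: "(h \<longlongrightarrow> m) at_top" "(w \<longlongrightarrow> P m) at_top"
    "\<forall>\<^sub>F t in at_top. (h has_real_derivative dh t) (at t)"
    "m = al \<and> 0 \<le> P m \<or> m < al \<and> P m = 0"
    using limit_cases unfolding dh_eq by blast
  from m(4) show ?thesis
  proof (elim disjE conjE)
    \<comment> \<open>\<open>P\<close> is negative strictly between its zeros, so only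
      \<open>al = tp\<close> remains, and \<open>tendsto_tp\<close> excludes it.\<close>
    assume "m = al" "0 \<le> P m"
    then have "al = tp" using assms Lam_pos mult_neg_pos[of "al - tp" "al - tm"]
      by (cases "al = tp") (auto simp: P_def zero_le_mult_iff)
    then have "P m = 0" using \<open>m = al\<close> by (simp add: P_zero_iff)
    then show ?thesis
      using tendsto_tp(1) m \<open>m = al\<close> \<open>al = tp\<close> by auto
  next
    assume "m < al" "P m = 0"
    then show ?thesis using tendsto_tm m assms by (auto simp: P_zero_iff)
  qed
qed

lemma asymptotics_critical:
  assumes "al = tm"
  shows "((\<lambda>t. w t * t) \<longlongrightarrow> Lam * tm * ((tp - tm) / 2)) at_top"
proof -
  obtain m where m: "(h \<longlongrightarrow> m) at_top" "(w \<longlongrightarrow> P m) at_top"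
    "\<forall>\<^sub>F t in at_top. (h has_real_derivative dh t) (at t)"
    "m = al \<and> 0 \<le> P m \<or> m < al \<and> P m = 0"
    using limit_cases unfolding dh_eq by blast
  then have "m = tm" using assms tm_less_tp by (auto simp: P_zero_iff)
  moreover from this have "P m = 0" by (simp add: P_zero_iff)
  ultimately show ?thesis using tendsto_critical m assms by auto
qed

text \<open>Both zeros of \<open>P\<close> exceed \<open>al\<close>, so the alternative
  \<open>m < al\<close> with \<open>P m = 0\<close> is impossible.\<close>

lemma asymptotics_supercritical:
  assumes "al < tm"
  shows "(w \<longlongrightarrow> P al) at_top"
proof -
  obtain m where m: "(w \<longlongrightarrow> P m) at_top" "m = al \<and> 0 \<le> P m \<or> m < al \<and> P m = 0"
    using limit_cases by blast
  then show ?thesis using assms tm_less_tp by (auto simp: P_zero_iff)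
qed

end

subsection \<open>Radial solutions\<close>

lemma pucci1_mult: "0 \<le> c \<Longrightarrow> pucci1 lam Lam (c * a) = c * pucci1 lam Lam a"
  using max_mult_distrib_left[of c a 0] min_mult_distrib_left[of c a 0]
  by (simp add: pucci1_def algebra_simps)

lemma pucci1_inv_pucci1: "0 < lam \<Longrightarrow> 0 < Lam \<Longrightarrow> pucci1_inv lam Lam (pucci1 lam Lam a) = a"
  by (cases "0 \<le> a") (auto simp: pucci1_inv_def pucci1_def mult_nonneg_nonpos max_def min_def mult_le_0_iff zero_le_mult_iff)

lemma radial_solution_pucci_flow:
  fixes u :: "real ^ 'n::finite \<Rightarrow> real"
  assumes lam: "0 < lam" "lam \<le> Lam"
    and sum: "Lam * (tp + tm) = lam * (real CARD('n) - 1) - Lam" and prod: "Lam * (tp * tm) = mu"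
    and tm: "0 < tm" "tm < tp" and "1 < p"
    and sol: "radial_solution lam Lam mu p u U"
  obtains h where "pucci_flow lam Lam mu (real CARD('n) - 1) p tp tm (\<lambda>t. ln (U (exp (- t)))) h"
proof -
  obtain U1 U2 where
    U1: "\<And>r. 0 < r \<Longrightarrow> r < 1 \<Longrightarrow> (U has_real_derivative U1 r) (at r)" and
    U2: "\<And>r. 0 < r \<Longrightarrow> r < 1 \<Longrightarrow> (U1 has_real_derivative U2 r) (at r)"
    using radial_profile_derivs[OF sol] by blast
  define n where "n = real CARD('n) - 1"
  define h where "h t = - (exp (- t) * U1 (exp (- t)) / U (exp (- t)))" for t
  have "pucci_flow lam Lam mu n p tp tm (\<lambda>t. ln (U (exp (- t)))) h"
  proof
    fix t :: real assume "0 < t"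
    define r where "r = exp (- t)"
    have r: "0 < r" "r < 1" using \<open>0 < t\<close> by (auto simp: r_def)
    have U_pos: "0 < U r" by (rule radial_profile_pos[OF sol r])
    have r_deriv: "((\<lambda>t. exp (- t)) has_real_derivative - r) (at t)"
      unfolding r_def by (auto intro!: derivative_eq_intros)
    have DU: "((\<lambda>t. U (exp (- t))) has_real_derivative U1 r * - r) (at t)"
      using U1[OF r] r_deriv unfolding r_def by (rule DERIV_chain2)
    have DU1: "((\<lambda>t. U1 (exp (- t))) has_real_derivative U2 r * - r) (at t)"
      using U2[OF r] r_deriv unfolding r_def by (rule DERIV_chain2)
    show "((\<lambda>t. ln (U (exp (- t)))) has_real_derivative h t) (at t)"
      using DU U_pos by (auto intro!: derivative_eq_intros simp: h_def divide_inverse simp flip: r_def)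
    define E where "E = exp ((p - 1) * ln (U (exp (- t))) - 2 * t)"
    have E: "E = r\<^sup>2 / U r * U r powr p"
    proof -
      have "r\<^sup>2 = exp (- (2 * t))" by (simp add: r_def power2_eq_square flip: exp_add)
      moreover have "E = exp (p * ln (U r) + - (2 * t) - ln (U r))"
        by (simp add: E_def r_def algebra_simps)
      ultimately have "E = exp (p * ln (U r)) * r\<^sup>2 / exp (ln (U r))"
        by (simp only: exp_add exp_diff)
      then show ?thesis using U_pos by (simp add: powr_def)
    qed
    have ode: "pucci1 lam Lam (U2 r) + n * pucci1 lam Lam (U1 r / r) + mu * U r / r\<^sup>2 = U r powr p"
      unfolding n_def by (rule radial_ode[OF sol U1 U2[OF r] r])
    \<comment> \<open>Multiplying the equation by \<open>r^2 / U\<close> makes it scale invariant;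
      by positive homogeneity the factor passes inside \<open>pucci1\<close>, and
      \<open>pucci1_inv\<close> then isolates \<open>r^2 U'' / U\<close>.\<close>
    have c: "0 \<le> r\<^sup>2 / U r" using U_pos by simp
    have "- h t = r\<^sup>2 / U r * (U1 r / r)"
      using r by (simp add: h_def power2_eq_square flip: r_def)
    then have "pucci1 lam Lam (- h t) = r\<^sup>2 / U r * pucci1 lam Lam (U1 r / r)"
      by (simp only: pucci1_mult[OF c])
    then have "E - mu - n * pucci1 lam Lam (- h t)
        = r\<^sup>2 / U r * (U r powr p - mu * U r / r\<^sup>2 - n * pucci1 lam Lam (U1 r / r))"
      using U_pos r by (simp add: E right_diff_distrib)
    also have "\<dots> = r\<^sup>2 / U r * pucci1 lam Lam (U2 r)" using ode by (simp flip: ode)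
    also have "\<dots> = pucci1 lam Lam (r\<^sup>2 / U r * U2 r)" by (simp only: pucci1_mult[OF c])
    finally have f: "slope_field lam Lam mu n (h t) E = r\<^sup>2 / U r * U2 r - h t - (h t)\<^sup>2"
      using lam by (simp add: slope_field_def pucci1_inv_pucci1)
    have "(h has_real_derivative
        - (((- r * U1 r + (U2 r * - r) * r) * U r - r * U1 r * (U1 r * - r)) / (U r * U r))) (at t)"
      unfolding h_def using DERIV_minus[OF DERIV_divide[OF DERIV_mult[OF r_deriv DU1] DU]] U_pos
      by (simp flip: r_def)
    also have "- (((- r * U1 r + (U2 r * - r) * r) * U r - r * U1 r * (U1 r * - r)) / (U r * U r))
        = r\<^sup>2 / U r * U2 r - h t - (h t)\<^sup>2"
      using U_pos by (simp add: h_def power2_eq_square field_simps flip: r_def)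
    finally show "(h has_real_derivative
        slope_field lam Lam mu n (h t) (exp ((p - 1) * ln (U (exp (- t))) - 2 * t))) (at t)"
      unfolding f E_def[symmetric] .
  qed (use assms in \<open>auto simp: n_def\<close>)
  then show ?thesis using that by (simp add: n_def)
qed

section \<open>Return to the variable \<open>r\<close>\<close>

lemma tendsto_at_right_0_via_exp:
  fixes g :: "real \<Rightarrow> real"
  assumes "(f \<longlongrightarrow> c) at_top" "\<And>r. 0 < r \<Longrightarrow> r < 1 \<Longrightarrow> g r = f (- ln r)"
  shows "(g \<longlongrightarrow> c) (at_right 0)"
proof -
  have "filterlim (\<lambda>r. - ln r) at_top (at_right (0 :: real))"
    using ln_at_0 by (simp add: filterlim_uminus_at_bot)
  from filterlim_compose[OF assms(1) this] have "((\<lambda>r. f (- ln r)) \<longlongrightarrow> c) (at_right 0)" .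
  moreover have "\<forall>\<^sub>F r in at_right 0. f (- ln r) = g r"
    using eventually_at_right_real[of 0 "1 :: real"] by (rule eventually_mono) (simp_all add: assms(2))
  ultimately show ?thesis by (rule Lim_transform_eventually)
qed

theorem theorem1p2:
  fixes lam Lam mu p N_plus tau lam_bar tau_p tau_m p_star p_dstar K K_bar :: real
    and u :: "real ^ 'n::finite \<Rightarrow> real" and U :: "real \<Rightarrow> real"
  assumes "0 < lam" and "lam \<le> Lam"
    and "N_plus = lam / Lam * (real CARD('n) - 1) + 1" and "N_plus > 2"
    and "tau = (N_plus - 2) / 2"
    and "lam_bar = Lam * tau\<^sup>2"
    and "0 < mu" and "mu < lam_bar"
    and "tau_p = tau + sqrt (tau\<^sup>2 - mu / Lam)"
    and "tau_m = tau - sqrt (tau\<^sup>2 - mu / Lam)"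
    and "p > 1"
    and "p_star = 1 + 2 / tau_p"
    and "p_dstar = 1 + 2 / tau_m"
    and "K = (Lam * (2 / (p - 1) - tau_p) * (2 / (p - 1) - tau_m)) powr (1 / (p - 1))"
    and "K_bar = (Lam * tau_m * (tau - tau_m)) powr (tau_m / 2)"
    and "radial_solution lam Lam mu p u U"
  shows "(p < p_star \<longrightarrow>
            ((\<lambda>r. r powr (2 / (p - 1)) * U r) \<longlongrightarrow> K) (at_right 0) \<or>
            (\<exists>c1>0. ((\<lambda>r. r powr tau_p * U r) \<longlongrightarrow> c1) (at_right 0)) \<or>
            (\<exists>c2>0. ((\<lambda>r. r powr tau_m * U r) \<longlongrightarrow> c2) (at_right 0))) \<and>
         (p_star \<le> p \<and> p < p_dstar \<longrightarrow>
            (\<exists>c2>0. ((\<lambda>r. r powr tau_m * U r) \<longlongrightarrow> c2) (at_right 0))) \<and>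
         (p = p_dstar \<longrightarrow>
            ((\<lambda>r. r powr tau_m * (- ln r) powr (tau_m / 2) * U r) \<longlongrightarrow> K_bar) (at_right 0)) \<and>
         (p > p_dstar \<longrightarrow>
            ((\<lambda>r. r powr (2 / (p - 1)) * U r) \<longlongrightarrow> K) (at_right 0))"
proof -
  have Lam: "0 < Lam" using assms(1,2) by simp
  \<comment> \<open>Here \<open>mu < lam_bar\<close> gives \<open>0 < d\<close> and
    \<open>0 < mu\<close> gives \<open>d < tau\<close>, so the two exponents are distinct and
    positive.\<close>
  define d where "d = sqrt (tau\<^sup>2 - mu / Lam)"
  have tau: "0 < tau" using assms(4,5) by simp
  have "mu / Lam < tau\<^sup>2" using assms(6,8) Lam by (simp add: field_simps)
  then have d: "0 < d" "d * d = tau\<^sup>2 - mu / Lam" by (simp_all add: d_def)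
  have taus: "tau_p = tau + d" "tau_m = tau - d" using assms(9,10) by (simp_all add: d_def)
  have "d * d < tau * tau" using d(2) assms(7) Lam by (simp add: power2_eq_square)
  then have "d < tau" using tau by (auto intro: power2_less_imp_less simp: power2_eq_square)
  then have tm: "0 < tau_m" "tau_m < tau_p" using d(1) by (simp_all add: taus)
  have sum: "Lam * (tau_p + tau_m) = lam * (real CARD('n) - 1) - Lam"
    using Lam by (simp add: taus assms(3,5) field_simps)
  have "tau_p * tau_m = tau\<^sup>2 - d * d" by (simp add: taus power2_eq_square algebra_simps)
  then have prod: "Lam * (tau_p * tau_m) = mu" using d(2) Lam by simp
  obtain h where "pucci_flow lam Lam mu (real CARD('n) - 1) p tau_p tau_m (\<lambda>t. ln (U (exp (- t)))) h"
    using radial_solution_pucci_flow[OF assms(1,2) sum prod tm assms(11,16)] by blast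
  then interpret pucci_flow lam Lam mu "real CARD('n) - 1" p tau_p tau_m "\<lambda>t. ln (U (exp (- t)))" h .
  let ?L = "\<lambda>t. ln (U (exp (- t)))"
  have U_eq: "r powr a * U r = exp (?L (- ln r) - a * (- ln r))" if "0 < r" "r < 1" for r a
    using that radial_profile_pos[OF assms(16) that] by (simp add: powr_def exp_add)
  have power_law: "\<exists>c'>0. ((\<lambda>r. r powr a * U r) \<longlongrightarrow> c') (at_right 0)"
    if "\<exists>c. ((\<lambda>t. ?L t - a * t) \<longlongrightarrow> c) at_top" for a
  proof -
    from that obtain c where "((\<lambda>t. ?L t - a * t) \<longlongrightarrow> c) at_top" by blast
    from tendsto_at_right_0_via_exp[OF tendsto_exp[OF this] U_eq]
    have "((\<lambda>r. r powr a * U r) \<longlongrightarrow> exp c) (at_right 0)" .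
    then show ?thesis using exp_gt_zero by blast
  qed
  have w_powr: "w t powr (1 / (p - 1)) = exp (?L t - al * t)" for t
    using assms(11) by (simp add: w_eq powr_def)
  \<comment> \<open>\<open>P al\<close> is the bracket in \<open>K\<close>; its being nonzero is
    required for passing to the limit inside the real power.\<close>
  have K_law: "((\<lambda>r. r powr (2 / (p - 1)) * U r) \<longlongrightarrow> K) (at_right 0)"
    if "(w \<longlongrightarrow> P al) at_top" "P al \<noteq> 0"
  proof -
    have "((\<lambda>r. r powr (2 / (p - 1)) * U r) \<longlongrightarrow> P al powr (1 / (p - 1))) (at_right 0)"
    proof (rule tendsto_at_right_0_via_exp[OF tendsto_powr[OF that(1) tendsto_const that(2)]])
      show "r powr (2 / (p - 1)) * U r = w (- ln r) powr (1 / (p - 1))" if "0 < r" "r < 1" for r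
        unfolding w_powr using U_eq[OF that] by (simp add: al_def)
    qed
    then show ?thesis by (simp add: assms(14) P_def al_def mult.assoc)
  qed
  \<comment> \<open>The map from \<open>p\<close> to \<open>2 / (p - 1)\<close> is decreasing, so
    the comparisons are reversed.\<close>
  have star: "p < p_star \<longleftrightarrow> tau_p < al" "p < p_dstar \<longleftrightarrow> tau_m < al" "p = p_dstar \<longleftrightarrow> al = tau_m"
    using tm assms(11) by (auto simp: assms(12,13) al_def field_simps)
  show ?thesis
  proof (intro conjI impI)
    assume "p < p_star"
    then have "tau_p < al" by (simp add: star)
    moreover from this have "P al \<noteq> 0" using tm by (simp add: P_zero_iff)
    ultimately show "((\<lambda>r. r powr (2 / (p - 1)) * U r) \<longlongrightarrow> K) (at_right 0) \<or>
        (\<exists>c1>0. ((\<lambda>r. r powr tau_p * U r) \<longlongrightarrow> c1) (at_right 0)) \<or>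
        (\<exists>c2>0. ((\<lambda>r. r powr tau_m * U r) \<longlongrightarrow> c2) (at_right 0))"
      using asymptotics_subcritical K_law power_law by blast
  next
    assume "p_star \<le> p \<and> p < p_dstar"
    then have "tau_m < al" "al \<le> tau_p" using star by auto
    then show "\<exists>c2>0. ((\<lambda>r. r powr tau_m * U r) \<longlongrightarrow> c2) (at_right 0)"
      by (intro power_law asymptotics_intermediate)
  next
    assume "p = p_dstar"
    then have al: "al = tau_m" by (simp add: star)
    let ?c = "Lam * tau_m * ((tau_p - tau_m) / 2)"
    have "?c = Lam * tau_m * (tau - tau_m)" by (simp add: taus)
    then have K_bar: "K_bar = ?c powr (tau_m / 2)" by (simp only: assms(15))
    have "?c \<noteq> 0" using Lam tm by simp
    with asymptotics_critical[OF al]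
    have "((\<lambda>t. (w t * t) powr (tau_m / 2)) \<longlongrightarrow> K_bar) at_top"
      unfolding K_bar by (intro tendsto_powr tendsto_const)
    then show "((\<lambda>r. r powr tau_m * (- ln r) powr (tau_m / 2) * U r) \<longlongrightarrow> K_bar) (at_right 0)"
    proof (rule tendsto_at_right_0_via_exp)
      fix r :: real assume r: "0 < r" "r < 1"
      have "tau_m / 2 = 1 / (p - 1)" using assms(11) by (simp add: al_def field_simps flip: al)
      then have "w (- ln r) powr (tau_m / 2) = r powr tau_m * U r"
        by (simp only: w_powr al U_eq[OF r])
      \<comment> \<open>Nonnegativity of both factors allows the power of the product to be
        split.\<close>
      moreover have "0 \<le> w (- ln r)" "0 \<le> - ln r" using r w_pos by (auto simp: less_imp_le)
      ultimately show "r powr tau_m * (- ln r) powr (tau_m / 2) * U r = (w (- ln r) * - ln r) powr (tau_m / 2)"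
        by (simp only: powr_mult) simp
    qed
  next
    assume "p > p_dstar"
    then have "\<not> tau_m < al" "al \<noteq> tau_m" by (simp_all flip: star)
    then have "al < tau_m" by simp
    moreover from this have "P al \<noteq> 0" using tm by (simp add: P_zero_iff)
    ultimately show "((\<lambda>r. r powr (2 / (p - 1)) * U r) \<longlongrightarrow> K) (at_right 0)"
      by (intro K_law asymptotics_supercritical)
  qed
qed

end
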